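(* Let $\gamma>0$ and $g\in L_1(\mathbb{R}_+;d\tau)$, and let $$(Gg)(x)=\int_0^\infty\left[\mathrm{ker}^2_{2i\tau}\left(2(4x)^{1/4}\right)+\mathrm{kei}^2_{2i\tau}\left(2(4x)^{1/4}\right)\right]g(\tau)\,d\tau,\qquad x>0.$$ Then $x^\gamma(Gg)(x)$ is bounded and continuous on $\mathbb{R}_+$ and $$\sup_{x>0}\left|x^\gamma(Gg)(x)\right|\le C_\gamma\|g\|_{L_1(\mathbb{R}_+;d\tau)},\qquad C_\gamma=\frac{4^{-\gamma}}{8\pi}B(\gamma,\gamma)\int_{\gamma-i\infty}^{\gamma+i\infty}\left|\Gamma^2(2s)\,ds\right|.$$ Besides, if $(Gg)(x)\in L_{\gamma,1}(\mathbb{R}_+)$ with $0<\gamma<1/2$, and its Mellin transform $(Gg)^*$ satisfies $|s|^{1/2-2\gamma}e^{\pi|s|/2}(Gg)^*(s)\in L_1(\gamma-i\infty,\gamma+i\infty)$, then for all $y>0$ $$\frac{1}{2\pi i}\int_{\gamma-i\infty}^{\gamma+i\infty}\frac{\Gamma(1/2-s)}{\Gamma(s)\Gamma(1/2+s)}(Gg)^*(s)\,y^{-s}ds=\frac{e^{y/2}}{8}\int_0^\infty K_{i\tau}\left(\frac y2\right)\frac{g(\tau)}{\cosh(\pi\tau)}\,d\tau.$$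
   Context: $\mathbb{R}_+=(0,\infty)$; functions are complex-valued. $\Gamma$ is Euler's gamma function and $B(a,b)$ Euler's beta function. $L_{\gamma,1}(\mathbb{R}_+)$ is the space of measurable $f$ with $\int_0^\infty|f(x)|x^{\gamma-1}dx<\infty$. The Mellin transform is $f^*(s)=\int_0^\infty f(x)x^{s-1}dx$. $L_1(\gamma-i\infty,\gamma+i\infty)$ denotes the functions absolutely integrable over the vertical line $\mathrm{Re}\,s=\gamma$. $K_\nu(z)$ is the modified Bessel function of the second kind, $K_\nu(z)=\int_0^\infty e^{-z\cosh y}\cosh(\nu y)\,dy$ for $\mathrm{Re}\,z>0$ and complex $\nu$. The Kelvin functions $\mathrm{ker}_\nu(x),\mathrm{kei}_\nu(x)$ ($x>0$, $\nu\in\mathbb{C}$) are defined by the pair of equations $\mathrm{ker}_\nu(x)\pm i\,\mathrm{kei}_\nu(x)=e^{\mp\nu\pi i/2}K_\nu\left(xe^{\pm\pi i/4}\right)$. *)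

theory Defs
  imports "HOL-Analysis.Analysis"
begin

definition bessel_K :: "complex \<Rightarrow> complex \<Rightarrow> complex" where
  "bessel_K \<nu> z =
     (LINT y:{0<..}|lebesgue. exp (- z * of_real (cosh y)) * cosh (\<nu> * of_real y))"

text \<open>
  The Kelvin functions are the solution of the linear system in
  \<open>kelvin_ker_kei_plus\<close> and \<open>kelvin_ker_kei_minus\<close> below. They are complex-valued:
  for non-real order they are in general not the real and imaginary part of either right-hand side.
\<close>

definition kelvin_ker :: "complex \<Rightarrow> real \<Rightarrow> complex" where
  "kelvin_ker \<nu> x =
     (exp (- \<nu> * of_real pi * \<i> / 2) * bessel_K \<nu> (of_real x * exp (of_real pi * \<i> / 4))
      + exp (\<nu> * of_real pi * \<i> / 2) * bessel_K \<nu> (of_real x * exp (- (of_real pi * \<i> / 4)))) / 2"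

definition kelvin_kei :: "complex \<Rightarrow> real \<Rightarrow> complex" where
  "kelvin_kei \<nu> x =
     (exp (- \<nu> * of_real pi * \<i> / 2) * bessel_K \<nu> (of_real x * exp (of_real pi * \<i> / 4))
      - exp (\<nu> * of_real pi * \<i> / 2) * bessel_K \<nu> (of_real x * exp (- (of_real pi * \<i> / 4)))) / (2 * \<i>)"

lemma kelvin_ker_kei_plus:
  "kelvin_ker \<nu> x + \<i> * kelvin_kei \<nu> x =
     exp (- \<nu> * of_real pi * \<i> / 2) * bessel_K \<nu> (of_real x * exp (of_real pi * \<i> / 4))"
  unfolding kelvin_ker_def kelvin_kei_def by (simp add: field_simps)

lemma kelvin_ker_kei_minus:
  "kelvin_ker \<nu> x - \<i> * kelvin_kei \<nu> x =
     exp (\<nu> * of_real pi * \<i> / 2) * bessel_K \<nu> (of_real x * exp (- (of_real pi * \<i> / 4)))"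
  unfolding kelvin_ker_def kelvin_kei_def by (simp add: field_simps)

definition kelvin_kernel :: "real \<Rightarrow> real \<Rightarrow> complex" where
  "kelvin_kernel x \<tau> =
     (kelvin_ker (2 * \<i> * of_real \<tau>) (2 * (4 * x) powr (1/4)))\<^sup>2
     + (kelvin_kei (2 * \<i> * of_real \<tau>) (2 * (4 * x) powr (1/4)))\<^sup>2"

definition kelvin_transform :: "(real \<Rightarrow> complex) \<Rightarrow> real \<Rightarrow> complex" where
  "kelvin_transform g x = (LINT \<tau>:{0<..}|lebesgue. kelvin_kernel x \<tau> * g \<tau>)"

definition weighted_L1 :: "real \<Rightarrow> (real \<Rightarrow> complex) set" where
  "weighted_L1 \<gamma> =
     {f. set_borel_measurable lebesgue {0<..} f \<and>
         set_integrable lebesgue {0<..} (\<lambda>x. norm (f x) * x powr (\<gamma> - 1))}"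

definition mellin :: "(real \<Rightarrow> complex) \<Rightarrow> complex \<Rightarrow> complex" where
  "mellin f s = (LINT x:{0<..}|lebesgue. f x * of_real x powr (s - 1))"

text \<open>Integration over the line \<open>Re s = \<gamma>\<close>, parametrised by \<open>s = \<gamma> + \<i> t\<close>, so \<open>ds = \<i> dt\<close>.\<close>

definition vline_integrable :: "real \<Rightarrow> (complex \<Rightarrow> complex) \<Rightarrow> bool" where
  "vline_integrable \<gamma> F \<longleftrightarrow> integrable lebesgue (\<lambda>t. F (Complex \<gamma> t))"

definition vline_integral :: "real \<Rightarrow> (complex \<Rightarrow> complex) \<Rightarrow> complex" where
  "vline_integral \<gamma> F = \<i> * (LINT t|lebesgue. F (Complex \<gamma> t))"

definition vline_abs_integral :: "real \<Rightarrow> (complex \<Rightarrow> complex) \<Rightarrow> real" where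
  "vline_abs_integral \<gamma> F = (LINT t|lebesgue. norm (F (Complex \<gamma> t)))"

definition kelvin_bound :: "real \<Rightarrow> real" where
  "kelvin_bound \<gamma> =
     4 powr (- \<gamma>) / (8 * pi) * Beta \<gamma> \<gamma> * vline_abs_integral \<gamma> (\<lambda>s. (Gamma (2 * s))\<^sup>2)"

end

theory Submission
  imports Defs "HOL-Probability.Characteristic_Functions" "HOL-Probability.Sinc_Integral"
begin

text \<open>
  The kernel is a product \<open>K\<^bsub>2i\<tau>\<^esub>(Z) K\<^bsub>2i\<tau>\<^esub>(z)\<close> with conjugate arguments. Writing it as a double
  integral, rotating the variables and shifting a contour turns it into the Fourier transform of
  \<open>y \<mapsto> K\<^sub>0(4 x\<^bsup>1/4\<^esup> (cosh y)\<^bsup>1/2\<^esup>) / 2\<close>, which is nonnegative. Hence all estimates reduce to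
  \<open>\<tau> = 0\<close>; the elementary bound \<open>2 w\<^bsup>a\<^esup> K\<^sub>0(w) \<le> \<Gamma>(a)\<close> gives the supremum bound, and its constant
  agrees with \<open>C\<^sub>\<gamma>\<close> by the Parseval identity
  \<open>\<integral> \<bar>\<Gamma>(a + iu)\<bar>\<^sup>2 du = 2 \<pi> 4\<^bsup>-a\<^esup> \<Gamma>(2a)\<close>.

  The Mellin transform of the kernel is \<open>4\<^bsup>-s\<^esup> \<Gamma>(2s) \<Gamma>(s + i\<tau>) \<Gamma>(s - i\<tau>) / 4\<close>. By the duplication formula
  the integrand of the inversion formula is then
  \<open>\<Gamma>(1/2 - s) \<Gamma>(s + i\<tau>) \<Gamma>(s - i\<tau>)\<close> integrated against \<open>g\<close>, and after exchanging the integrals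
  the claim is the inverse Mellin transform of this triple product. It follows by Fourier inversion from
  \<open>\<integral> v\<^bsup>-1/2\<^esup> e\<^bsup>-v\<^esup> 2 K\<^bsub>2i\<tau>\<^esub>(2 (vy)\<^bsup>1/2\<^esup>) dv = \<pi>\<^bsup>1/2\<^esup> e\<^bsup>y/2\<^esup> K\<^bsub>i\<tau>\<^esub>(y/2) / cosh(\<pi>\<tau>)\<close>.
  All integrals are taken over the whole line in logarithmic variables.
\<close>

section \<open>Integration on the line and Fourier inversion\<close>

text \<open>Why the contour shift works: with p = m + b and q = m - b the exponent Z cosh p + z cosh
  q is a positive multiple of cosh (b + i t), where t depends on m alone. Shifting b by i t
  therefore leaves K_0 at a positive argument, and the order survives only in a phase in m. Since
  that phase has modulus 1, every estimate is uniform in \<tau>, which is what integration against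
  an arbitrary integrable g demands. Decay of Gamma on vertical lines enters only through |Gamma (a
  + i t)| \<le> Gamma (a + 1) / |a + i t|, which is square integrable. This suffices because Gamma
  (s + i \<tau>) Gamma (s - i \<tau>) is bounded by the mean of two squares, and these are
  translates in t, so their integrals do not depend on \<tau>. The integral over v arises because
  Gamma (1/2 - s) and Gamma (s + i \<tau>) Gamma (s - i \<tau>) are Mellin transforms of an
  exponential and of a Bessel function; the inverse transform of the product is their Mellin
  convolution.\<close>

lemma borel_measurable_cosh [measurable]: "(cosh :: 'a::{real_normed_field, banach} \<Rightarrow> 'a) \<in> borel_measurable borel"
  by (intro borel_measurable_continuous_onI continuous_intros)

lemma borel_measurable_sinh [measurable]: "(sinh :: 'a::{real_normed_field, banach} \<Rightarrow> 'a) \<in> borel_measurable borel"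
  by (intro borel_measurable_continuous_onI continuous_intros)

lemma Re_pos_not_nonpos_Ints: "Re z > 0 \<Longrightarrow> z \<notin> \<int>\<^sub>\<le>\<^sub>0"
  by (auto elim!: nonpos_Ints_cases)

text \<open>For Borel integrands the completion of \<open>lborel\<close> makes no difference, so the
  substitution rule for absolutely integrable functions carries over. Measurability is asked of the
  extensions by zero, which leaves \<open>f\<close> free outside \<open>T\<close>.\<close>

lemma lborel_integral_change_of_variables:
  fixes f :: "real \<Rightarrow> 'a :: euclidean_space" and h :: "real \<Rightarrow> real"
  assumes S: "S \<in> sets borel" and T: "h ` S = T" "T \<in> sets borel"
    and der: "\<And>x. x \<in> S \<Longrightarrow> (h has_field_derivative h' x) (at x)"
    and inj: "inj_on h S"
    and [measurable]: "(\<lambda>x. indicator T x *\<^sub>R f x) \<in> borel_measurable borel"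
      "(\<lambda>x. indicator S x *\<^sub>R (\<bar>h' x\<bar> *\<^sub>R f (h x))) \<in> borel_measurable borel"
  shows "set_integrable lborel S (\<lambda>x. \<bar>h' x\<bar> *\<^sub>R f (h x)) \<longleftrightarrow> set_integrable lborel T f"
    "(LINT x:S|lborel. \<bar>h' x\<bar> *\<^sub>R f (h x)) = (LINT x:T|lborel. f x)"
proof -
  have eq: "(\<lambda>x. \<bar>h' x\<bar> *\<^sub>R f (h x)) absolutely_integrable_on S \<and>
      integral S (\<lambda>x. \<bar>h' x\<bar> *\<^sub>R f (h x)) = b
      \<longleftrightarrow> f absolutely_integrable_on T \<and> integral T f = b" for b
    unfolding T(1)[symmetric]
    by (rule has_absolute_integral_change_of_variables_real)
      (use S inj der in \<open>auto intro: has_field_derivative_at_within\<close>)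
  have 1: "set_integrable lborel A F \<longleftrightarrow> F absolutely_integrable_on A"
    "(LINT x:A|lborel. F x) = (LINT x:A|lebesgue. F x)"
    if "(\<lambda>x. indicator A x *\<^sub>R F x) \<in> borel_measurable borel" for A and F :: "real \<Rightarrow> 'a"
    using that unfolding set_integrable_def set_lebesgue_integral_def
    by (simp_all add: integrable_completion integral_completion)
  note T1 = 1[OF assms(6)] and S1 = 1[OF assms(7)]
  show iff: "set_integrable lborel S (\<lambda>x. \<bar>h' x\<bar> *\<^sub>R f (h x)) \<longleftrightarrow> set_integrable lborel T f"
    unfolding T1 S1 using eq by blast
  show "(LINT x:S|lborel. \<bar>h' x\<bar> *\<^sub>R f (h x)) = (LINT x:T|lborel. f x)"
  proof (cases "set_integrable lborel T f")
    case True
    then have "f absolutely_integrable_on T" "(\<lambda>x. \<bar>h' x\<bar> *\<^sub>R f (h x)) absolutely_integrable_on S"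
      using iff unfolding T1 S1 by simp_all
    then show ?thesis
      unfolding T1 S1 using eq by (simp add: set_lebesgue_integral_eq_integral(2))
  next
    \<comment> \<open>Both sides fail to be integrable together, and both integrals then take the
      default value 0.\<close>
    case False
    then show ?thesis
      using iff by (simp add: set_integrable_def set_lebesgue_integral_def not_integrable_integral_eq)
  qed
qed

lemma change_of_variables_exp:
  fixes f :: "real \<Rightarrow> 'a :: euclidean_space"
  assumes [measurable]: "(\<lambda>x. indicator {0<..} x *\<^sub>R f x) \<in> borel_measurable borel"
  shows "integrable lborel (\<lambda>p. exp p *\<^sub>R f (exp p)) \<longleftrightarrow> set_integrable lborel {0<..} f"
    "(LINT p|lborel. exp p *\<^sub>R f (exp p)) = (LINT x:{0<..}|lborel. f x)"
proof -
  have r: "range exp = {0::real<..}"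
    by (auto simp: image_iff intro: exp_ln[symmetric])
  have m: "(\<lambda>x. indicator UNIV x *\<^sub>R (\<bar>exp x\<bar> *\<^sub>R f (exp x))) \<in> borel_measurable borel"
  proof -
    have "(\<lambda>x. exp x *\<^sub>R (indicator {0<..} (exp x) *\<^sub>R f (exp x))) \<in> borel_measurable borel"
      by (intro borel_measurable_scaleR borel_measurable_exp measurable_compose[OF borel_measurable_exp assms])
    then show ?thesis by simp
  qed
  have j: "inj (exp :: real \<Rightarrow> real)" by (simp add: inj_on_def)
  note c = lborel_integral_change_of_variables[of UNIV exp "{0<..}" exp f]
  show "integrable lborel (\<lambda>p. exp p *\<^sub>R f (exp p)) \<longleftrightarrow> set_integrable lborel {0<..} f"
    using c(1) m r j by (auto simp: set_integrable_def intro: DERIV_exp)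
  show "(LINT p|lborel. exp p *\<^sub>R f (exp p)) = (LINT x:{0<..}|lborel. f x)"
    using c(2) m r j by (auto simp: set_lebesgue_integral_def intro: DERIV_exp)
qed

text \<open>Dominated convergence along sequences, whose tails lie in \<open>S\<close>. Domination
  on a neighbourhood suffices, which suits majorants that blow up as the argument tends to
  0.\<close>

lemma isCont_integral_dominated:
  fixes f :: "'a::{first_countable_topology,t2_space} \<Rightarrow> 'b \<Rightarrow> 'c::{banach, second_countable_topology}"
  assumes "open S" "x \<in> S"
    and "\<And>x. x \<in> S \<Longrightarrow> f x \<in> borel_measurable M"
    and cont: "\<And>t. t \<in> space M \<Longrightarrow> isCont (\<lambda>x. f x t) x"
    and w: "integrable M w"
    and bd: "\<And>x t. x \<in> S \<Longrightarrow> t \<in> space M \<Longrightarrow> norm (f x t) \<le> w t"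
  shows "isCont (\<lambda>x. integral\<^sup>L M (f x)) x"
  unfolding isCont_def
proof (rule tendsto_at_iff_sequentially[THEN iffD2], intro allI impI)
  fix X assume X: "\<forall>i. X i \<in> UNIV - {x}" "X \<longlonglongrightarrow> x"
  obtain N where N: "\<And>n. n \<ge> N \<Longrightarrow> X n \<in> S"
    using topological_tendstoD[OF X(2) assms(1,2)] by (auto simp: eventually_sequentially)
  have "(\<lambda>n. integral\<^sup>L M (f (X (n + N)))) \<longlonglongrightarrow> integral\<^sup>L M (f x)"
  proof (rule integral_dominated_convergence)
    show "AE t in M. (\<lambda>n. f (X (n + N)) t) \<longlonglongrightarrow> f x t"
    proof (rule AE_I2)
      fix t assume "t \<in> space M"
      from isCont_tendsto_compose[OF cont[OF this] X(2)]
      show "(\<lambda>n. f (X (n + N)) t) \<longlonglongrightarrow> f x t" by (rule LIMSEQ_ignore_initial_segment)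
    qed
  qed (use assms N in auto)
  then show "((\<lambda>x. integral\<^sup>L M (f x)) \<circ> X) \<longlonglongrightarrow> integral\<^sup>L M (f x)"
    by (simp add: LIMSEQ_offset o_def)
qed

text \<open>The substitution \<open>p = m + b\<close>, \<open>q = m - b\<close>, whose Jacobian is \<open>2\<close>.\<close>

lemma
  fixes F :: "real \<Rightarrow> real \<Rightarrow> 'a :: {banach, second_countable_topology}"
  assumes F: "integrable (lborel \<Otimes>\<^sub>M lborel) (case_prod F)"
  shows integrable_hyperbolic_rotation:
      "integrable (lborel \<Otimes>\<^sub>M lborel) (\<lambda>(b, m). F (m + b) (m - b))"
    and integral_hyperbolic_rotation:
      "2 *\<^sub>R (LINT b|lborel. LINT m|lborel. F (m + b) (m - b)) = (LINT p|lborel. LINT q|lborel. F p q)"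
proof -
  have [measurable]: "case_prod F \<in> borel_measurable (borel \<Otimes>\<^sub>M borel)"
    using borel_measurable_integrable[OF F] by simp
  \<comment> \<open>The rotation is split into two substitutions of one variable each: q = p - 2 b
    at fixed p, which produces the factor 2, then p = m + b at fixed b.\<close>
  have i1: "integrable (lborel \<Otimes>\<^sub>M lborel) (\<lambda>(p, b). F p (p - 2 * b))"
  proof (rule lborel_pair.Fubini_integrable)
    have "(LINT b|lborel. norm (F p (p - 2 * b))) = (LINT q|lborel. norm (F p q)) / 2" for p
      by (subst lborel_integral_real_affine[of "-2" "\<lambda>q. norm (F p q)" p]) simp_all
    moreover have "integrable lborel (\<lambda>p. (LINT q|lborel. norm (F p q)) / 2)"
      using lborel_pair.integrable_fst'[OF integrable_norm[OF F]] by simp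
    ultimately show "integrable lborel (\<lambda>p. LINT b|lborel. norm (case (p, b) of (p, b) \<Rightarrow> F p (p - 2 * b)))"
      by (simp only: prod.case)
    show "AE p in lborel. integrable lborel (\<lambda>b. case (p, b) of (p, b) \<Rightarrow> F p (p - 2 * b))"
      using lborel_pair.AE_integrable_fst'[OF F]
    proof eventually_elim
      case (elim p)
      then show ?case using lborel_integrable_real_affine[of "F p" "-2" p] by simp
    qed
  qed simp
  show "integrable (lborel \<Otimes>\<^sub>M lborel) (\<lambda>(b, m). F (m + b) (m - b))"
  proof (rule lborel_pair.Fubini_integrable)
    have i1': "integrable (lborel \<Otimes>\<^sub>M lborel) (\<lambda>(b, p). norm (F p (p - 2 * b)))"
      using integrable_norm[OF lborel_pair.integrable_product_swap[OF i1]] by (simp add: case_prod_unfold)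
    have "(LINT m|lborel. norm (F (m + b) (m - b))) = (LINT p|lborel. norm (F p (p - 2 * b)))" for b
      by (subst lborel_integral_real_affine[of 1 "\<lambda>p. norm (F p (p - 2 * b))" b]) (simp_all add: add.commute)
    moreover have "integrable lborel (\<lambda>b. LINT p|lborel. norm (F p (p - 2 * b)))"
      using lborel_pair.integrable_fst'[OF i1'] by simp
    ultimately show "integrable lborel (\<lambda>b. LINT m|lborel. norm (case (b, m) of (b, m) \<Rightarrow> F (m + b) (m - b)))"
      by simp
    show "AE b in lborel. integrable lborel (\<lambda>m. case (b, m) of (b, m) \<Rightarrow> F (m + b) (m - b))"
      using lborel_pair.AE_integrable_snd[OF i1]
    proof eventually_elim
      case (elim b)
      then show ?case using lborel_integrable_real_affine[of "\<lambda>p. F p (p - 2 * b)" 1 b] by (simp add: add.commute)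
    qed
  qed simp
  have "(LINT b|lborel. LINT m|lborel. F (m + b) (m - b)) = (LINT b|lborel. LINT p|lborel. F p (p - 2 * b))"
  proof (rule Bochner_Integration.integral_cong[OF refl])
    fix b
    show "(LINT m|lborel. F (m + b) (m - b)) = (LINT p|lborel. F p (p - 2 * b))"
      by (subst lborel_integral_real_affine[of 1 "\<lambda>p. F p (p - 2 * b)" b]) (simp_all add: add.commute)
  qed
  also have "\<dots> = (LINT p|lborel. LINT b|lborel. F p (p - 2 * b))"
    by (rule lborel_pair.Fubini_integral[OF i1])
  also have "2 *\<^sub>R \<dots> = (LINT p|lborel. LINT q|lborel. F p q)"
  proof -
    have "(LINT q|lborel. F p q) = 2 *\<^sub>R (LINT b|lborel. F p (p - 2 * b))" for p
      by (subst lborel_integral_real_affine[of "-2" "\<lambda>q. F p q" p]) simp_all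
    then show ?thesis by simp
  qed
  finally show "2 *\<^sub>R (LINT b|lborel. LINT m|lborel. F (m + b) (m - b)) = (LINT p|lborel. LINT q|lborel. F p q)" .
qed

text \<open>Euler's integral in the variable p = ln t; the scaling by \<open>c\<close> becomes a
  translation by \<open>ln c\<close>.\<close>

lemma
  assumes "Re s > 0" and c: "c > 0"
  shows integrable_Gamma_exp: "integrable lborel (\<lambda>p. exp (s * of_real p - of_real (c * exp p)))"
    and integral_Gamma_exp: "(LINT p|lborel. exp (s * of_real p - of_real (c * exp p)))
           = exp (- s * of_real (ln c)) * Gamma s"
proof -
  define f where "f = (\<lambda>t::real. of_real t powr (s - 1) / of_real (exp t) :: complex)"
  have fe: "exp p *\<^sub>R f (exp p) = exp (s * of_real p - of_real (exp p))" for p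
  proof -
    have "exp p *\<^sub>R f (exp p) = exp (of_real p) * (exp ((s - 1) * of_real p) * exp (- of_real (exp p)))"
      by (simp add: f_def powr_def Ln_of_real scaleR_conv_of_real exp_minus field_simps flip: exp_of_real)
    then show ?thesis by (simp add: algebra_simps flip: exp_add)
  qed
  have [measurable]: "(\<lambda>x. indicator {0<..} x *\<^sub>R f x) \<in> borel_measurable borel"
  proof -
    have "(\<lambda>x. indicator {0<..} x *\<^sub>R (exp ((s - 1) * of_real (ln x)) / of_real (exp x))) \<in> borel_measurable borel"
      by measurable
    also have "(\<lambda>x. indicator {0<..} x *\<^sub>R (exp ((s - 1) * of_real (ln x)) / of_real (exp x))) =
       (\<lambda>x. indicator {0<..} x *\<^sub>R f x)"
      by (auto simp: fun_eq_iff f_def powr_def Ln_of_real indicator_def)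
    finally show ?thesis .
  qed
  have ai: "f absolutely_integrable_on {0<..}"
    using absolutely_integrable_Gamma_integral'[OF assms(1)] by (simp add: f_def)
  have i: "set_integrable lborel {0<..} f" and v: "(LINT x:{0<..}|lborel. f x) = Gamma s"
    using ai set_lebesgue_integral_eq_integral(2)[OF ai] Gamma_integral_complex'[OF assms(1)]
    by (simp_all add: set_integrable_def set_lebesgue_integral_def integrable_completion
       integral_completion integral_unique f_def[symmetric])
  have 1: "integrable lborel (\<lambda>p. exp (s * of_real p - of_real (exp p)))"
    and 2: "(LINT p|lborel. exp (s * of_real p - of_real (exp p))) = Gamma s"
    using i v change_of_variables_exp[of f] by (simp_all add: fe)
  have *: "exp (s * of_real (ln c + 1 * p) - of_real (exp (ln c + 1 * p))) =
     exp (s * of_real (ln c)) * exp (s * of_real p - of_real (c * exp p))" for p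
      proof -
    have "exp (ln c + 1 * p) = c * exp p"
      using c by (simp add: exp_add)
    then show ?thesis by (simp add: algebra_simps flip: exp_add[where 'a = complex])
  qed
  have e: "exp (s * of_real (ln c)) \<noteq> 0" by simp
  show "integrable lborel (\<lambda>p. exp (s * of_real p - of_real (c * exp p)))"
  proof -
    have "integrable lborel (\<lambda>p. exp (- s * of_real (ln c)) *
       (exp (s * of_real (ln c)) * exp (s * of_real p - of_real (c * exp p))))"
      using lborel_integrable_real_affine[OF 1, of 1 "ln c"] unfolding * by (rule integrable_mult_right) simp
    moreover have "exp (- s * of_real (ln c)) * (exp (s * of_real (ln c)) * X) = X" for X
      by (simp add: exp_minus)
    ultimately show ?thesis by (simp only:)
  qed
  show "(LINT p|lborel. exp (s * of_real p - of_real (c * exp p))) = exp (- s * of_real (ln c)) * Gamma s"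
    using lborel_integral_real_affine[of 1 "\<lambda>p. exp (s * of_real p - of_real (exp p))" "ln c"]
    unfolding * 2 by (simp add: exp_minus field_simps)
qed

lemma integral_Gaussian_exp:
  fixes u e :: real
  assumes "e > 0"
  shows "integrable lborel (\<lambda>t. exp (\<i> * of_real (u * t) - of_real ((e * t)\<^sup>2 / 2)))"
    and "(LINT t|lborel. exp (\<i> * of_real (u * t) - of_real ((e * t)\<^sup>2 / 2)))
      = of_real (sqrt (2 * pi) / e * exp (- (u / e)\<^sup>2 / 2))"
proof -
  have sd: "std_normal_density t *\<^sub>R exp (\<i> * of_real (v * t)) =
     exp (\<i> * of_real (v * t) - of_real (t\<^sup>2 / 2)) / of_real (sqrt (2 * pi))" for v t
  proof -
    have "std_normal_density t *\<^sub>R exp (\<i> * of_real (v * t)) =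
       (exp (\<i> * of_real (v * t)) * exp (- of_real (t\<^sup>2 / 2))) / of_real (sqrt (2 * pi))"
      by (simp add: std_normal_density_def scaleR_conv_of_real flip: exp_of_real)
    then show ?thesis by (simp flip: exp_add)
  qed
  have i0: "integrable lborel (\<lambda>t. std_normal_density t *\<^sub>R exp (\<i> * of_real (v * t)))" for v
    by (rule Bochner_Integration.integrable_bound[OF integrable_normal_density[of 1 0]])
       (auto simp: norm_mult)
  have i: "integrable lborel (\<lambda>t. exp (\<i> * of_real (v * t) - of_real (t\<^sup>2 / 2)))" for v
    using integrable_mult_right[OF i0[of v], of "of_real (sqrt (2 * pi))"] unfolding sd by simp
  have v: "(LINT t|lborel. exp (\<i> * of_real (v * t) - of_real (t\<^sup>2 / 2)))
      = of_real (sqrt (2 * pi) * exp (- v\<^sup>2 / 2))" for v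
  proof -
    have "char std_normal_distribution v = (LINT t|lborel. std_normal_density t *\<^sub>R exp (\<i> * of_real (v * t)))"
      unfolding char_def by (subst integral_density) (auto simp: normal_density_nonneg)
    then show ?thesis
      unfolding sd char_std_normal_distribution by (simp add: field_simps)
  qed
  have *: "exp (\<i> * of_real (u / e * (0 + e * t)) - of_real ((0 + e * t)\<^sup>2 / 2)) =
     exp (\<i> * of_real (u * t) - of_real ((e * t)\<^sup>2 / 2))" for t
    using assms by simp
  show "integrable lborel (\<lambda>t. exp (\<i> * of_real (u * t) - of_real ((e * t)\<^sup>2 / 2)))"
    using lborel_integrable_real_affine[OF i[of "u/e"], of e 0] assms unfolding * by simp
  show "(LINT t|lborel. exp (\<i> * of_real (u * t) - of_real ((e * t)\<^sup>2 / 2)))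
      = of_real (sqrt (2 * pi) / e * exp (- (u / e)\<^sup>2 / 2))"
    using lborel_integral_real_affine[of e "\<lambda>t. exp (\<i> * of_real (u / e * t) - of_real (t\<^sup>2 / 2))" 0] assms
    unfolding * v by (simp add: scaleR_conv_of_real field_simps)
qed

text \<open>Gaussian summation: the factor exp (- (e t)^2 / 2) makes Fubini available and turns the
  left side into an average of \<open>f\<close> against a Gaussian of width e around
  \<open>x0\<close>. As e tends to 0, \<open>F\<close> dominates on the left, while the bound
  \<open>B\<close> and the continuity at \<open>x0\<close> settle the limit on the right.\<close>

lemma Fourier_inversion_at:
  fixes f :: "real \<Rightarrow> complex"
  assumes f: "integrable lborel f" and bd: "\<And>x. norm (f x) \<le> B" and cont: "isCont f x0"
    and F: "\<And>t. F t = (LINT y|lborel. exp (\<i> * of_real (t * y)) * f y)"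
    and iF: "integrable lborel F"
  shows "(LINT t|lborel. F t * exp (- \<i> * of_real (t * x0))) = 2 * of_real pi * f x0"
proof -
  have [measurable]: "f \<in> borel_measurable borel" "F \<in> borel_measurable borel"
    using f iF by auto
  define e where "e = (\<lambda>n. inverse (real (Suc n)))"
  have e: "e n > 0" for n by (simp add: e_def)
  have e0: "e \<longlonglongrightarrow> 0" unfolding e_def by (rule LIMSEQ_inverse_real_of_nat)
  define I where "I = (\<lambda>n. LINT t|lborel. F t * exp (- \<i> * of_real (t * x0)) * of_real (exp (- (e n * t)\<^sup>2 / 2)))"
  have 1: "I \<longlonglongrightarrow> (LINT t|lborel. F t * exp (- \<i> * of_real (t * x0)))"
    unfolding I_def
  proof (rule integral_dominated_convergence[where w = "\<lambda>t. norm (F t)"])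
    show "AE t in lborel. (\<lambda>n. F t * exp (- \<i> * of_real (t * x0)) * of_real (exp (- (e n * t)\<^sup>2 / 2)))
       \<longlonglongrightarrow> F t * exp (- \<i> * of_real (t * x0))"
    proof (rule AE_I2)
      fix t
      have "(\<lambda>n. F t * exp (- \<i> * of_real (t * x0)) * of_real (exp (- (e n * t)\<^sup>2 / 2)))
        \<longlonglongrightarrow> F t * exp (- \<i> * of_real (t * x0)) * of_real (exp (- (0 * t)\<^sup>2 / 2))"
        by (intro tendsto_intros e0) auto
      then show "(\<lambda>n. F t * exp (- \<i> * of_real (t * x0)) * of_real (exp (- (e n * t)\<^sup>2 / 2)))
        \<longlonglongrightarrow> F t * exp (- \<i> * of_real (t * x0))" by simp
    qed
  qed (use iF in \<open>auto simp: norm_mult intro!: mult_left_le\<close>)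
  have I: "I n = of_real (sqrt (2 * pi)) * (LINT z|lborel. f (x0 + e n * z) * of_real (exp (- z\<^sup>2 / 2)))" for n
  proof -
    let ?G = "\<lambda>t y. exp (\<i> * of_real ((y - x0) * t) - of_real ((e n * t)\<^sup>2 / 2))"
    have nG: "norm (?G t y) = exp (- (e n * t)\<^sup>2 / 2)" for t y
      by simp
    have "integrable lborel (\<lambda>t. exp (- (e n * t)\<^sup>2 / 2))"
      using integrable_norm[OF integral_Gaussian_exp(1)[OF e, of 0 n]] by simp
    then have "integrable (lborel \<Otimes>\<^sub>M lborel) (\<lambda>(t, y). ?G t y * f y)"
      by (intro lborel_pair.Fubini_integrable)
         (use f in \<open>auto simp: norm_mult nG intro!: AE_I2 Bochner_Integration.integrable_bound[of _ f] mult_left_le_one_le\<close>)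
    then have Fub: "(LINT t|lborel. LINT y|lborel. ?G t y * f y) = (LINT y|lborel. LINT t|lborel. ?G t y * f y)"
      by (rule lborel_pair.Fubini_integral[symmetric])
    have "I n = (LINT t|lborel. LINT y|lborel. ?G t y * f y)"
      unfolding I_def F
    proof (intro Bochner_Integration.integral_cong refl)
      fix t
      have "?G t y * f y = (exp (- \<i> * of_real (t * x0)) * of_real (exp (- (e n * t)\<^sup>2 / 2))) *
        (exp (\<i> * of_real (t * y)) * f y)" for y
        by (simp add: exp_of_real[symmetric] algebra_simps flip: exp_add)
      then have "(LINT y|lborel. ?G t y * f y) = (exp (- \<i> * of_real (t * x0)) * of_real (exp (- (e n * t)\<^sup>2 / 2))) *
         (LINT y|lborel. exp (\<i> * of_real (t * y)) * f y)"
        by (simp only: integral_mult_right_zero)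
      then show "(LINT y|lborel. exp (\<i> * of_real (t * y)) * f y) * exp (- \<i> * of_real (t * x0)) *
           of_real (exp (- (e n * t)\<^sup>2 / 2)) = (LINT y|lborel. ?G t y * f y)"
        by (simp add: mult_ac)
    qed
    also have "\<dots> = (LINT y|lborel. of_real (sqrt (2 * pi) / e n * exp (- ((y - x0) / e n)\<^sup>2 / 2)) * f y)"
      unfolding Fub integral_mult_left_zero integral_Gaussian_exp(2)[OF e] ..
    also have "\<dots> = e n *\<^sub>R (LINT z|lborel. of_real (sqrt (2 * pi) / e n * exp (- z\<^sup>2 / 2)) * f (x0 + e n * z))"
      using e[of n] by (subst lborel_integral_real_affine[of "e n" _ x0]) auto
    also have "\<dots> = of_real (sqrt (2 * pi)) * (LINT z|lborel. f (x0 + e n * z) * of_real (exp (- z\<^sup>2 / 2)))"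
    proof -
      have "of_real (sqrt (2 * pi) / e n * exp (- z\<^sup>2 / 2)) * f (x0 + e n * z) =
        of_real (sqrt (2 * pi) / e n) * (f (x0 + e n * z) * of_real (exp (- z\<^sup>2 / 2)))" for z
        by (simp add: mult_ac)
      then show ?thesis
        using e[of n] by (simp only: integral_mult_right_zero) (simp add: scaleR_conv_of_real)
    qed
    finally show ?thesis .
  qed
  have g1: "integrable lborel (\<lambda>z::real. exp (- z\<^sup>2 / 2))"
    using integrable_norm[OF integral_Gaussian_exp(1)[of 1 0]] by simp
  have g2: "(LINT z|lborel. of_real (exp (- z\<^sup>2 / 2))) = complex_of_real (sqrt (2 * pi))"
    using integral_Gaussian_exp(2)[of 1 0] by (simp flip: exp_of_real)
  have "(\<lambda>n. LINT z|lborel. f (x0 + e n * z) * of_real (exp (- z\<^sup>2 / 2))) \<longlonglongrightarrow>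
     (LINT z|lborel. f x0 * of_real (exp (- z\<^sup>2 / 2)))"
  proof (rule integral_dominated_convergence[where w = "\<lambda>z. B * exp (- z\<^sup>2 / 2)"])
    show "AE z in lborel. (\<lambda>n. f (x0 + e n * z) * of_real (exp (- z\<^sup>2 / 2))) \<longlonglongrightarrow> f x0 * of_real (exp (- z\<^sup>2 / 2))"
    proof (intro AE_I2 tendsto_intros isCont_tendsto_compose[OF cont])
      fix z
      have "(\<lambda>n. x0 + e n * z) \<longlonglongrightarrow> x0 + 0 * z" by (intro tendsto_intros e0)
      then show "(\<lambda>n. x0 + e n * z) \<longlonglongrightarrow> x0" by simp
    qed
  qed (use g1 bd in \<open>auto simp: norm_mult\<close>)
  then have 2: "I \<longlonglongrightarrow> of_real (sqrt (2 * pi)) * (LINT z|lborel. f x0 * of_real (exp (- z\<^sup>2 / 2)))"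
    unfolding I by (intro tendsto_intros)
  have "complex_of_real (sqrt (2 * pi)) * of_real (sqrt (2 * pi)) = of_real (2 * pi)"
    unfolding of_real_mult[symmetric] by simp
  then have "of_real (sqrt (2 * pi)) * (LINT z|lborel. f x0 * of_real (exp (- z\<^sup>2 / 2))) = 2 * of_real pi * f x0"
    unfolding integral_mult_right_zero g2 by (simp add: algebra_simps)
  with LIMSEQ_unique[OF 1 2] show ?thesis by simp
qed

section \<open>Bessel functions of imaginary order and Gamma integrals\<close>

text \<open>For \<open>w > 0\<close> these are \<open>2 K\<^bsub>ir\<^esub>(w)\<close> and \<open>2 K\<^sub>0(w)\<close>. As integrals over the whole line
  they are jointly measurable in all arguments.\<close>

definition bessel_F :: "real \<Rightarrow> real \<Rightarrow> complex" where
  "bessel_F r w = (LINT b|lborel. exp (\<i> * of_real (r * b) - of_real (w * cosh b)))"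

definition bessel_L :: "real \<Rightarrow> real" where
  "bessel_L w = (LINT b|lborel. exp (- w * cosh b))"

lemma
  fixes a c :: real
  assumes "a > 0" and "c > 0"
  shows integrable_Gamma_exp_real: "integrable lborel (\<lambda>p. exp (a * p - c * exp p))"
    and integral_Gamma_exp_real: "(LINT p|lborel. exp (a * p - c * exp p)) = exp (- a * ln c) * Gamma a"
proof -
  have e: "exp (complex_of_real a * of_real p - of_real (c * exp p)) = of_real (exp (a * p - c * exp p))" for p
    by (simp flip: exp_of_real)
  show 1: "integrable lborel (\<lambda>p. exp (a * p - c * exp p))"
    using integrable_norm[OF integrable_Gamma_exp[of "of_real a" c]] assms unfolding e by simp
  have "complex_of_real (LINT p|lborel. exp (a * p - c * exp p)) =
      exp (- of_real a * of_real (ln c)) * Gamma (of_real a)"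
    using integral_Gamma_exp[of "of_real a" c] assms unfolding e by (simp only: integral_complex_of_real) simp
  also have "\<dots> = of_real (exp (- a * ln c) * Gamma a)"
    by (simp add: Gamma_complex_of_real flip: exp_of_real)
  finally have "complex_of_real (LINT p|lborel. exp (a * p - c * exp p)) = of_real (exp (- a * ln c) * Gamma a)" .
  then show "(LINT p|lborel. exp (a * p - c * exp p)) = exp (- a * ln c) * Gamma a"
    by (simp only: of_real_eq_iff)
qed

text \<open>The AM-GM inequality splits the exponential of \<open>cosh\<close> into two integrands of Euler type.
  The bound is the exact value of the absolute Mellin-Barnes integral of \<open>K\<^sub>0\<close>, so the sharp constant
  of the theorem is reached without Mellin inversion.\<close>

lemma
  fixes a w :: real
  assumes a: "a > 0" and w: "w > 0"
  shows integrable_exp_cosh: "integrable lborel (\<lambda>b. exp (- w * cosh b))"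
    and bessel_L_bound: "w powr a * bessel_L w \<le> Gamma a"
proof -
  define h where "h = (\<lambda>b. exp (a * b - w * exp b))"
  have h: "integrable lborel h" "(LINT b|lborel. h b) = exp (- a * ln w) * Gamma a"
    using integrable_Gamma_exp_real[OF a w] integral_Gamma_exp_real[OF a w] by (simp_all add: h_def)
  have h': "integrable lborel (\<lambda>b. h (- b))" "(LINT b|lborel. h (- b)) = exp (- a * ln w) * Gamma a"
    using lborel_integrable_real_affine[OF h(1), of "-1" 0] lborel_integral_real_affine[of "-1" h 0] h(2) by simp_all
  have le: "exp (- w * cosh b) \<le> (h b + h (- b)) / 2" for b
  proof -
    \<comment> \<open>The factors exp (a b / 2) and exp (- a b / 2) cancel in \<open>u * v\<close>,
      so the exponent \<open>a\<close> is free.\<close>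
    define u v where "u = exp (a * b / 2 - w * exp b / 2)" and "v = exp (- a * b / 2 - w * exp (- b) / 2)"
    have "0 \<le> (u - v)\<^sup>2" by simp
    also have "\<dots> = u\<^sup>2 + v\<^sup>2 - 2 * (u * v)" by (simp add: power2_eq_square algebra_simps)
    also have "u\<^sup>2 + v\<^sup>2 = h b + h (- b)"
      by (simp_all add: u_def v_def h_def power2_eq_square flip: exp_add)
    also have "u * v = exp (- w * cosh b)"
      by (simp add: u_def v_def cosh_field_def field_simps flip: exp_add)
    finally show ?thesis by simp
  qed
  have hh: "integrable lborel (\<lambda>b. (h b + h (- b)) / 2)"
    using h(1) h'(1) by simp
  show i: "integrable lborel (\<lambda>b. exp (- w * cosh b))"
    by (rule Bochner_Integration.integrable_bound[OF hh]) (use le in \<open>auto intro: order_trans[OF _ abs_ge_self]\<close>)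
  have "bessel_L w \<le> (LINT b|lborel. (h b + h (- b)) / 2)"
    unfolding bessel_L_def by (rule integral_mono[OF i hh]) (rule le)
  also have "\<dots> = exp (- a * ln w) * Gamma a"
    using h h' by simp
  finally have "w powr a * bessel_L w \<le> w powr a * (exp (- a * ln w) * Gamma a)"
    by (intro mult_left_mono) auto
  also have "\<dots> = Gamma a" using w by (simp add: powr_def exp_minus)
  finally show "w powr a * bessel_L w \<le> Gamma a" .
qed

lemma integrable_exp_cosh_complex:
  assumes "Re z > 0"
  shows "integrable lborel (\<lambda>b. exp (\<i> * of_real (r * b) - z * of_real (cosh b)))"
  by (rule Bochner_Integration.integrable_bound[OF integrable_exp_cosh[of 1 "Re z"]]) (use assms in auto)

text \<open>Half of the exponent absorbs the factor \<open>cosh b\<close>, through x \<le> exp x at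
  x = (w / 2) cosh b. This controls the derivative in the contour shift.\<close>

lemma integrable_cosh_exp_cosh:
  fixes w :: real
  assumes "w > 0"
  shows "integrable lborel (\<lambda>b. cosh b * exp (- w * cosh b))"
proof (rule Bochner_Integration.integrable_bound)
  show "integrable lborel (\<lambda>b. 2 / w * exp (- (w / 2) * cosh b))"
    using integrable_exp_cosh[of 1 "w / 2"] assms by simp
  have "cosh b * exp (- w * cosh b) \<le> 2 / w * exp (- (w / 2) * cosh b)" for b
  proof -
    have "w / 2 * cosh b \<le> exp (w / 2 * cosh b)"
      using exp_ge_add_one_self[of "w / 2 * cosh b"] by linarith
    then have "w / 2 * cosh b * exp (- w * cosh b) \<le> exp (w / 2 * cosh b) * exp (- w * cosh b)"
      by (intro mult_right_mono) auto
    also have "\<dots> = exp (- (w / 2) * cosh b)"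
      by (simp flip: exp_add add: field_simps)
    finally show ?thesis using assms by (simp add: field_simps)
  qed
  then show "AE b in lborel. norm (cosh b * exp (- w * cosh b)) \<le> norm (2 / w * exp (- (w / 2) * cosh b))"
    using assms by (auto simp: abs_mult)
qed simp

lemma borel_measurable_bessel_F [measurable (raw)]:
  assumes [measurable]: "f \<in> borel_measurable M" "g \<in> borel_measurable M"
  shows "(\<lambda>x. bessel_F (f x) (g x)) \<in> borel_measurable M"
  unfolding bessel_F_def by measurable

lemma borel_measurable_bessel_L [measurable]: "bessel_L \<in> borel_measurable borel"
  unfolding bessel_L_def by measurable

lemma bessel_L_nonneg: "bessel_L w \<ge> 0"
  unfolding bessel_L_def by simp

lemma norm_bessel_F_le: "norm (bessel_F r w) \<le> bessel_L w"
  unfolding bessel_F_def bessel_L_def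
  by (rule order_trans[OF integral_norm_bound]) simp

lemma bessel_F_0: "bessel_F 0 w = of_real (bessel_L w)"
  unfolding bessel_F_def bessel_L_def
  by (subst integral_complex_of_real[symmetric]) (simp flip: exp_of_real)

lemma isCont_bessel_F:
  assumes "w > 0"
  shows "isCont (bessel_F r) w"
  unfolding bessel_F_def[abs_def]
proof (rule isCont_integral_dominated)
  show "open {w / 2<..}" "w \<in> {w / 2<..}" using assms by auto
  show "integrable lborel (\<lambda>b. exp (- (w / 2) * cosh b))"
    by (rule integrable_exp_cosh[of 1]) (use assms in auto)
qed (auto intro!: continuous_intros)

text \<open>Two Euler integrals in logarithmic variables p and q are multiplied and rotated, using
  exp p + exp q = 2 exp m cosh b. Integrating m first leaves a power of \<open>cosh b\<close>,
  integrating b first leaves a Bessel function; the next two results are these two readings of one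
  double integral.\<close>

lemma
  fixes s :: complex and r :: real
  assumes s: "Re s > 0"
  shows integrable_Gamma_Gamma: "integrable (lborel \<Otimes>\<^sub>M lborel)
      (\<lambda>(b, m). exp (2 * s * of_real m + \<i> * of_real (r * b) - of_real (2 * exp m * cosh b)))"
    and Gamma_Gamma_integral: "2 * (LINT b|lborel. LINT m|lborel.
        exp (2 * s * of_real m + \<i> * of_real (r * b) - of_real (2 * exp m * cosh b)))
       = Gamma (s + \<i> * of_real r / 2) * Gamma (s - \<i> * of_real r / 2)"
proof -
  define F where "F = (\<lambda>p q. exp ((s + \<i> * of_real r / 2) * of_real p - of_real (1 * exp p)) *
     exp ((s - \<i> * of_real r / 2) * of_real q - of_real (1 * exp q)))"
  have i1: "integrable lborel (\<lambda>p. exp ((s + \<i> * of_real r / 2) * of_real p - of_real (1 * exp p)))"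
    and i2: "integrable lborel (\<lambda>p. exp ((s - \<i> * of_real r / 2) * of_real p - of_real (1 * exp p)))"
    by (rule integrable_Gamma_exp; use s in simp)+
  have F: "F (m + b) (m - b) = exp (2 * s * of_real m + \<i> * of_real (r * b) - of_real (2 * exp m * cosh b))" for b m
  proof -
    have c: "2 * exp m * cosh b = exp (m + b) + exp (m - b)"
      by (simp add: cosh_field_def exp_add exp_diff exp_minus field_simps)
    show ?thesis
      unfolding F_def c exp_add[symmetric] by (rule arg_cong[of _ _ exp]) (simp add: field_simps)
  qed
  have iF: "integrable (lborel \<Otimes>\<^sub>M lborel) (case_prod F)"
    unfolding F_def
  proof (rule lborel_pair.Fubini_integrable, goal_cases)
    case 2
    then show ?case using integrable_norm[OF i1] by (simp only: prod.case norm_mult integral_mult_right_zero) simp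
  next
    case 3
    then show ?case using i2 by simp
  qed simp
  show "integrable (lborel \<Otimes>\<^sub>M lborel)
      (\<lambda>(b, m). exp (2 * s * of_real m + \<i> * of_real (r * b) - of_real (2 * exp m * cosh b)))"
    using integrable_hyperbolic_rotation[OF iF] unfolding F .
  have "(LINT p|lborel. LINT q|lborel. F p q) = Gamma (s + \<i> * of_real r / 2) * Gamma (s - \<i> * of_real r / 2)"
    unfolding F_def integral_mult_right_zero
    using s by (simp add: integral_Gamma_exp[of _ 1, simplified])
  then show "2 * (LINT b|lborel. LINT m|lborel.
        exp (2 * s * of_real m + \<i> * of_real (r * b) - of_real (2 * exp m * cosh b)))
       = Gamma (s + \<i> * of_real r / 2) * Gamma (s - \<i> * of_real r / 2)"
    using integral_hyperbolic_rotation[OF iF] unfolding F by (simp add: scaleR_conv_of_real)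
qed

lemma
  fixes s :: complex and r :: real
  assumes s: "Re s > 0"
  shows integrable_cosh_powr: "integrable lborel (\<lambda>b. exp (- 2 * s * of_real (ln (2 * cosh b))))"
    and Fourier_cosh_powr: "2 * Gamma (2 * s) *
       (LINT b|lborel. exp (\<i> * of_real (r * b)) * exp (- 2 * s * of_real (ln (2 * cosh b))))
       = Gamma (s + \<i> * of_real r / 2) * Gamma (s - \<i> * of_real r / 2)"
proof -
  have inner: "(LINT m|lborel. exp (2 * s * of_real m + \<i> * of_real (r * b) - of_real (2 * exp m * cosh b)))
    = Gamma (2 * s) * (exp (\<i> * of_real (r * b)) * exp (- 2 * s * of_real (ln (2 * cosh b))))"
    if s: "Re s > 0" for b and s :: complex and r
  proof -
    have "exp (2 * s * of_real m + \<i> * of_real (r * b) - of_real (2 * exp m * cosh b)) =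
      exp (\<i> * of_real (r * b)) * exp (2 * s * of_real m - of_real (2 * cosh b * exp m))" for m
      by (simp add: algebra_simps flip: exp_add)
    then show ?thesis
      using integral_Gamma_exp[of "2 * s" "2 * cosh b"] s by (simp add: mult_ac)
  qed
  \<comment> \<open>At the real point \<open>Re s\<close> and order 0 the inner integral is, up to
    the nonzero factor Gamma (2 Re s), the modulus of the function to be integrated.\<close>
  let ?s = "of_real (Re s) :: complex"
  have "integrable lborel (\<lambda>b. LINT m|lborel. exp (2 * ?s * of_real m + \<i> * of_real (0 * b) - of_real (2 * exp m * cosh b)))"
    using lborel_pair.integrable_fst[OF integrable_Gamma_Gamma[of ?s 0]] s by simp
  then have i: "integrable lborel (\<lambda>b. (Gamma (2 * ?s) * (exp (\<i> * of_real (0 * b)) * exp (- 2 * ?s * of_real (ln (2 * cosh b))))))"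
    by (subst (asm) inner) (use s in auto)
  have "Gamma (2 * ?s) \<noteq> 0"
    using s by (simp add: Gamma_eq_zero_iff Re_pos_not_nonpos_Ints)
  then have "integrable lborel (\<lambda>b. exp (- 2 * ?s * of_real (ln (2 * cosh b))))"
    using integrable_mult_right[OF i, of "inverse (Gamma (2 * ?s))"] by (simp add: mult.assoc[symmetric])
  then show "integrable lborel (\<lambda>b. exp (- 2 * s * of_real (ln (2 * cosh b))))"
    by (rule Bochner_Integration.integrable_bound) auto
  show "2 * Gamma (2 * s) *
       (LINT b|lborel. exp (\<i> * of_real (r * b)) * exp (- 2 * s * of_real (ln (2 * cosh b))))
       = Gamma (s + \<i> * of_real r / 2) * Gamma (s - \<i> * of_real r / 2)"
    unfolding Gamma_Gamma_integral[OF s, symmetric] inner[OF s] by simp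
qed

lemma
  fixes s :: complex and r :: real
  assumes s: "Re s > 0"
  shows integrable_Mellin_bessel_F: "integrable lborel (\<lambda>m. exp (2 * s * of_real m) * bessel_F r (2 * exp m))"
    and Mellin_bessel_F: "2 * (LINT m|lborel. exp (2 * s * of_real m) * bessel_F r (2 * exp m))
       = Gamma (s + \<i> * of_real r / 2) * Gamma (s - \<i> * of_real r / 2)"
proof -
  note G = integrable_Gamma_Gamma[OF s, of r]
  have inner: "(LINT b|lborel. exp (2 * s * of_real m + \<i> * of_real (r * b) - of_real (2 * exp m * cosh b)))
    = exp (2 * s * of_real m) * bessel_F r (2 * exp m)" for m
    unfolding bessel_F_def integral_mult_right_zero[symmetric]
    by (simp add: algebra_simps flip: exp_add)
  show "integrable lborel (\<lambda>m. exp (2 * s * of_real m) * bessel_F r (2 * exp m))"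
    using lborel_pair.integrable_snd[OF G] unfolding inner .
  show "2 * (LINT m|lborel. exp (2 * s * of_real m) * bessel_F r (2 * exp m))
       = Gamma (s + \<i> * of_real r / 2) * Gamma (s - \<i> * of_real r / 2)"
    unfolding Gamma_Gamma_integral[OF s, symmetric] lborel_pair.Fubini_integral[OF G, symmetric] inner ..
qed

section \<open>The kernel\<close>

lemma integral_even:
  fixes f :: "real \<Rightarrow> 'a :: {banach, second_countable_topology}"
  assumes f: "integrable lborel f" and even: "\<And>x. f (- x) = f x"
  shows "(LINT x|lborel. f x) = 2 *\<^sub>R (LINT x:{0<..}|lborel. f x)"
proof -
  have [measurable]: "f \<in> borel_measurable borel" using f by auto
  have i: "set_integrable lborel {0<..} f"
    unfolding set_integrable_def by (rule integrable_mult_indicator) (use f in auto)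
  then have i1: "integrable lborel (\<lambda>x. indicator {0<..} x *\<^sub>R f x)"
    by (simp add: set_integrable_def)
  have i2: "integrable lborel (\<lambda>x. indicator {0<..} (- x) *\<^sub>R f x)"
    using lborel_integrable_real_affine[OF i1, of "-1" 0] by (simp add: even)
  have "(LINT x|lborel. f x) = (LINT x|lborel. indicator {0<..} x *\<^sub>R f x + indicator {0<..} (- x) *\<^sub>R f x)"
    by (rule integral_cong_AE) (use AE_lborel_singleton[of 0] in \<open>auto simp: indicator_def elim!: eventually_mono\<close>)
  also have "\<dots> = (LINT x|lborel. indicator {0<..} x *\<^sub>R f x) + (LINT x|lborel. indicator {0<..} (- x) *\<^sub>R f x)"
    by (rule Bochner_Integration.integral_add[OF i1 i2])
  also have "(LINT x|lborel. indicator {0<..} (- x) *\<^sub>R f x) = (LINT x|lborel. indicator {0<..} x *\<^sub>R f x)"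
    using lborel_integral_real_affine[of "-1" "\<lambda>x. indicator {0<..} x *\<^sub>R f x" 0] by (simp add: even)
  finally show ?thesis by (simp add: set_lebesgue_integral_def scaleR_2)
qed

text \<open>The hyperbolic cosine of an imaginary argument is the mean of two exponentials
  interchanged by reflection, so the half line can be replaced by half of the whole line.\<close>

lemma bessel_K_integral:
  assumes z: "Re z > 0"
  shows "bessel_K (\<i> * of_real r) z = (LINT b|lborel. exp (\<i> * of_real (r * b) - z * of_real (cosh b))) / 2"
proof -
  define E where "E = (\<lambda>b. exp (\<i> * of_real (r * b) - z * of_real (cosh b)))"
  define C where "C = (\<lambda>b. exp (- z * of_real (cosh b)) * cosh (\<i> * of_real r * of_real b))"
  have CE: "C b = (E b + E (- b)) / 2" for b
  proof -
    have "C b = (exp (- z * of_real (cosh b)) * exp (\<i> * of_real r * of_real b) +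
       exp (- z * of_real (cosh b)) * exp (- (\<i> * of_real r * of_real b))) / 2"
      unfolding C_def cosh_field_def[of "\<i> * of_real r * of_real b"] by (simp add: algebra_simps)
    moreover have "- z * of_real (cosh b) + - (\<i> * of_real r * of_real b) =
        \<i> * of_real (r * - b) - z * of_real (cosh (- b))"
      "- z * of_real (cosh b) + \<i> * of_real r * of_real b = \<i> * of_real (r * b) - z * of_real (cosh b)"
      by simp_all
    ultimately show ?thesis
      unfolding E_def exp_add[symmetric] by (simp only:)
  qed
  have E: "integrable lborel E" unfolding E_def by (rule integrable_exp_cosh_complex[OF z])
  have E': "integrable lborel (\<lambda>b. E (- b))"
    using lborel_integrable_real_affine[OF E, of "-1" 0] by simp
  have C: "integrable lborel C" unfolding CE[abs_def] using E E' by simp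
  have "(LINT b|lborel. E (- b)) = (LINT b|lborel. E b)"
    using lborel_integral_real_affine[of "-1" E 0] by simp
  then have "(LINT b|lborel. E b) = (LINT b|lborel. C b)"
    unfolding CE using E E' by simp
  also have "\<dots> = 2 *\<^sub>R (LINT b:{0<..}|lborel. C b)"
    by (rule integral_even[OF C]) (simp add: CE)
  also have "(LINT b:{0<..}|lborel. C b) = bessel_K (\<i> * of_real r) z"
    unfolding bessel_K_def set_lebesgue_integral_def C_def
    by (subst integral_completion) auto
  finally show ?thesis unfolding E_def by (simp add: scaleR_conv_of_real)
qed

lemma bessel_K_eq_bessel_F:
  assumes "w > 0"
  shows "bessel_K (\<i> * of_real r) (of_real w) = bessel_F r w / 2"
  using bessel_K_integral[of "of_real w" r] assms by (simp add: bessel_F_def)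

text \<open>Here \<open>cosh b cos t + \<i> sinh b sin t\<close> is \<open>cosh (b + \<i> t)\<close>: the path of integration is
  moved within the strip where the integrand decays, because the derivative in \<open>t\<close> of the
  integrand is \<open>\<i>\<close> times its derivative in \<open>b\<close>, whose integral vanishes.\<close>

lemma bessel_L_contour_shift:
  fixes w t :: real
  assumes w: "w > 0" and t: "\<bar>t\<bar> < pi / 2"
  shows "(LINT b|lborel. exp (- of_real w * (of_real (cosh b * cos t) + \<i> * of_real (sinh b * sin t)))) = of_real (bessel_L w)"
proof -
  define c where "c = (\<lambda>b t. of_real (cosh b * cos t) + \<i> * of_real (sinh b * sin t))"
  \<comment> \<open>\<open>s\<close> is sinh (b + i t), and \<open>d\<close> below is the derivative
    of \<open>f\<close> in b.\<close>
  define s where "s = (\<lambda>b t. of_real (sinh b * cos t) + \<i> * of_real (cosh b * sin t))"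
  define f where "f = (\<lambda>b t. exp (- of_real w * c b t))"
  define d where "d = (\<lambda>b t. - of_real w * s b t * f b t)"
  have [measurable]: "case_prod d \<in> borel_measurable (borel \<Otimes>\<^sub>M borel)"
    "case_prod f \<in> borel_measurable (borel \<Otimes>\<^sub>M borel)"
    unfolding d_def f_def c_def s_def by measurable
  have dt: "((\<lambda>t. f b t) has_vector_derivative \<i> * d b t) (at t within A)" for b t A
    unfolding f_def d_def
    by (rule has_vector_derivative_eq_rhs, rule field_vector_diff_chain_within[unfolded o_def, where g = exp])
       (auto simp: c_def s_def algebra_simps intro!: derivative_eq_intros)
  have db: "((\<lambda>b. f b t) has_vector_derivative d b t) (at b within A)" for b t A
    unfolding f_def d_def
    by (rule has_vector_derivative_eq_rhs, rule field_vector_diff_chain_within[unfolded o_def, where g = exp])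
       (auto simp: c_def s_def algebra_simps intro!: derivative_eq_intros)
  \<comment> \<open>The modulus decays in b exactly as long as \<open>cos t\<close> is positive,
    whence the range of t.\<close>
  have nf: "norm (f b t) = exp (- (w * cos t) * cosh b)" for b t
    by (simp add: f_def c_def)
  have ns: "norm (s b t) \<le> cosh b" for b t
  proof -
    have "(norm (s b t))\<^sup>2 = (sinh b)\<^sup>2 * (cos t)\<^sup>2 + (cosh b)\<^sup>2 * (sin t)\<^sup>2"
      by (simp add: s_def cmod_power2 power_mult_distrib)
    also have "\<dots> \<le> (cosh b)\<^sup>2 * (cos t)\<^sup>2 + (cosh b)\<^sup>2 * (sin t)\<^sup>2"
      by (intro add_mono mult_right_mono) (auto simp: cosh_square_eq)
    also have "\<dots> = (cosh b)\<^sup>2" by (simp flip: distrib_left)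
    finally show ?thesis by (rule power2_le_imp_le) simp
  qed
  have shift: "(LINT b|lborel. f b t) = (LINT b|lborel. f b 0)" if t: "0 \<le> t" "t < pi / 2" for t
  proof -
    have ct: "cos t > 0" using t by (intro cos_gt_zero_pi) auto
    have cu: "cos t \<le> cos u" if "u \<in> {0..t}" for u
      using that t by (intro cos_monotone_0_pi_le) auto
    have if': "integrable lborel (\<lambda>b. f b u)" if "u \<in> {0..t}" for u
      by (rule Bochner_Integration.integrable_bound[OF integrable_exp_cosh[of 1 "w * cos t"]])
         (use w ct cu[OF that] in \<open>auto simp: nf mult_left_mono mult_right_mono\<close>)
    \<comment> \<open>The cosine decreases on \<open>{0..t}\<close>, so the slowest decay occurs at
      the endpoint t and gives one majorant for all intermediate contours.\<close>
    define W where "W = (\<lambda>b. w * (cosh b * exp (- (w * cos t) * cosh b)))"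
    have W: "integrable lborel W"
      using integrable_cosh_exp_cosh[of "w * cos t"] w ct by (simp add: W_def)
    have nd: "norm (d b u) \<le> W b" if "u \<in> {0..t}" for b u
    proof -
      have "norm (d b u) = w * (norm (s b u) * exp (- (w * cos u) * cosh b))"
        using w by (simp add: d_def norm_mult nf)
      also have "\<dots> \<le> W b"
      proof -
        have "exp (- (w * cos u) * cosh b) \<le> exp (- (w * cos t) * cosh b)"
          using w cu[OF that] by (simp add: mult_right_mono)
        then show ?thesis
          unfolding W_def using w ns[of b u] by (intro mult_left_mono mult_mono) auto
      qed
      finally show ?thesis .
    qed
    have id: "integrable lborel (\<lambda>b. d b u)" if "u \<in> {0..t}" for u
      by (rule Bochner_Integration.integrable_bound[OF W]) (use nd[OF that] in \<open>auto intro: order_trans[OF _ abs_ge_self]\<close>)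
    have d0: "(LINT b|lborel. d b u) = 0" if u: "u \<in> {0..t}" for u
    proof -
      \<comment> \<open>One argument for a general filter serves both ends of the line;
        \<open>\<bar>b\<bar> / 2 \<le> cosh b\<close> gives exponential decay in
        \<open>\<bar>b\<bar>\<close>.\<close>
      have lim: "((\<lambda>b. f b u) \<longlongrightarrow> 0) F" if F: "filterlim (\<lambda>b::real. \<bar>b\<bar>) at_top F" for F :: "real filter"
      proof (rule tendsto_norm_zero_cancel,
            rule tendsto_sandwich[where f = "\<lambda>_. 0" and h = "\<lambda>b. exp (- (w * cos u / 2 * \<bar>b\<bar>))"])
        have cu': "0 < w * cos u" using w ct cu[OF u] by (intro mult_pos_pos) auto
        show "eventually (\<lambda>b. norm (f b u) \<le> exp (- (w * cos u / 2 * \<bar>b::real\<bar>))) F"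
        proof (rule always_eventually, rule allI)
          fix b :: real
          have "\<bar>b\<bar> \<le> exp \<bar>b\<bar>" using exp_ge_add_one_self[of "\<bar>b\<bar>"] by linarith
          also have "\<dots> \<le> 2 * cosh \<bar>b\<bar>" by (simp add: cosh_field_def)
          finally have "\<bar>b\<bar> / 2 \<le> cosh b" by (simp add: abs_if split: if_splits)
          then have "w * cos u * (\<bar>b\<bar> / 2) \<le> w * cos u * cosh b"
            using cu' by (intro mult_left_mono) auto
          then show "norm (f b u) \<le> exp (- (w * cos u / 2 * \<bar>b\<bar>))"
            unfolding nf by simp
        qed
        have "LIM b F. w * cos u / 2 * \<bar>b\<bar> :> at_top"
          by (rule filterlim_tendsto_pos_mult_at_top[OF tendsto_const _ F]) (use cu' in simp)
        then show "((\<lambda>b. exp (- (w * cos u / 2 * \<bar>b\<bar>))) \<longlongrightarrow> 0) F"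
          by (intro filterlim_compose[OF exp_at_bot]) (simp add: filterlim_uminus_at_bot)
      qed auto
      have "(LBINT b=-\<infinity>..\<infinity>. d b u) = 0 - 0"
      proof (rule interval_integral_FTC_integrable[where F = "\<lambda>b. f b u"])
        show "((\<lambda>b. f b u) has_vector_derivative d b u) (at b)" for b by (rule db)
        show "isCont (\<lambda>b. d b u) b" for b
          unfolding d_def f_def s_def c_def by (intro continuous_intros)
        show "set_integrable lborel (einterval (- \<infinity>) \<infinity>) (\<lambda>b. d b u)"
          using id[OF u] by (simp add: set_integrable_def)
        have "filterlim (\<lambda>b::real. \<bar>b\<bar>) at_top at_top" "filterlim (\<lambda>b::real. \<bar>b\<bar>) at_top at_bot"
          by (auto intro: filterlim_abs_real filterlim_at_infinity_imp_norm_at_top[where 'b = real, unfolded real_norm_def]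
            filterlim_mono[OF filterlim_ident at_bot_le_at_infinity order_refl])
        from this[THEN lim] show "(((\<lambda>b. f b u) \<circ> real_of_ereal) \<longlongrightarrow> 0) (at_right (- \<infinity>))"
            "(((\<lambda>b. f b u) \<circ> real_of_ereal) \<longlongrightarrow> 0) (at_left \<infinity>)"
          by (simp_all add: ereal_tendsto_simps)
      qed simp
      then show ?thesis
        by (simp add: interval_lebesgue_integral_def set_lebesgue_integral_def)
    qed
    \<comment> \<open>The cutoff to \<open>{0..t}\<close> writes the fundamental theorem as an
      integral over the whole line, so that Fubini brings in the vanishing integral
      \<open>d0\<close>.\<close>
    define J where "J = (\<lambda>u b. indicator {0..t} u *\<^sub>R (\<i> * d b u))"
    have J: "integrable (lborel \<Otimes>\<^sub>M lborel) (case_prod J)"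
    proof (rule lborel_pair.Fubini_integrable)
      show "case_prod J \<in> borel_measurable (lborel \<Otimes>\<^sub>M lborel)"
        unfolding J_def by measurable
      show "AE u in lborel. integrable lborel (\<lambda>b. case (u, b) of (u, b) \<Rightarrow> J u b)"
        using id by (auto simp: J_def indicator_def)
      show "integrable lborel (\<lambda>u. LINT b|lborel. norm (case (u, b) of (u, b) \<Rightarrow> J u b))"
      proof (rule Bochner_Integration.integrable_bound)
        show "integrable lborel (\<lambda>u. indicator {0..t} u *\<^sub>R (LINT b|lborel. W b))"
          by (intro integrable_scaleR_left) (simp add: integrable_indicator_iff emeasure_lborel_Icc_eq)
        show "(\<lambda>u. LINT b|lborel. norm (case (u, b) of (u, b) \<Rightarrow> J u b)) \<in> borel_measurable lborel"
          unfolding J_def by measurable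
        show "AE u in lborel. norm (LINT b|lborel. norm (case (u, b) of (u, b) \<Rightarrow> J u b)) \<le>
            norm (indicator {0..t} u *\<^sub>R (LINT b|lborel. W b))"
        proof (rule AE_I2)
          fix u
          show "norm (LINT b|lborel. norm (case (u, b) of (u, b) \<Rightarrow> J u b)) \<le>
            norm (indicator {0..t} u *\<^sub>R (LINT b|lborel. W b))"
          proof (cases "u \<in> {0..t}")
            case True
            then have "(LINT b|lborel. norm (d b u)) \<le> (LINT b|lborel. W b)"
              by (intro integral_mono integrable_norm id W nd)
            then show ?thesis using True by (simp add: J_def norm_mult)
          qed (simp add: J_def)
        qed
      qed
    qed
    have FTC: "f b t - f b 0 = (LINT u|lborel. J u b)" for b
    proof -
      have "continuous_on {0..t} (\<lambda>u. \<i> * d b u)"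
        unfolding d_def f_def s_def c_def by (intro continuous_intros)
      from integral_FTC_Icc[OF t(1) dt this] show ?thesis by (simp add: J_def)
    qed
    have "(LINT b|lborel. f b t) - (LINT b|lborel. f b 0) = (LINT b|lborel. f b t - f b 0)"
      using if' t by simp
    also have "\<dots> = (LINT u|lborel. LINT b|lborel. J u b)"
      unfolding FTC by (rule lborel_pair.Fubini_integral[OF J])
    also have "\<dots> = 0"
    proof -
      have "(LINT b|lborel. J u b) = 0" for u
        using d0[of u] by (cases "u \<in> {0..t}") (simp_all add: J_def)
      then show ?thesis by simp
    qed
    finally show ?thesis by simp
  qed
  have "(LINT b|lborel. f b t) = (LINT b|lborel. f b 0)"
  proof (cases "0 \<le> t")
    case True
    then show ?thesis using t by (intro shift) auto
  next
    case False
    have "(LINT b|lborel. f b t) = (LINT b|lborel. f (- b) t)"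
      using lborel_integral_real_affine[of "-1" "\<lambda>b. f b t" 0] by simp
    also have "\<dots> = (LINT b|lborel. f b (- t))"
      unfolding f_def c_def by simp
    also have "\<dots> = (LINT b|lborel. f b 0)"
      using False t by (intro shift) auto
    finally show ?thesis .
  qed
  also have "\<dots> = of_real (bessel_L w)"
    using bessel_F_0[of w] by (simp add: bessel_F_def f_def c_def)
  finally show ?thesis by (simp add: f_def c_def)
qed


lemma bessel_K_conjugate_product:
  fixes X r :: real
  assumes X: "X > 0"
  shows "bessel_K (\<i> * of_real r) (of_real X * exp (of_real pi * \<i> / 4))
       * bessel_K (\<i> * of_real r) (of_real X * exp (- (of_real pi * \<i> / 4)))
     = (LINT y|lborel. exp (\<i> * of_real (r * y)) * of_real (bessel_L (sqrt 2 * X * sqrt (cosh y)))) / 4"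
proof -
  define X' where "X' = X / sqrt 2"
  have X': "X' > 0" "sqrt 2 * X = 2 * X'" using X by (simp_all add: X'_def field_simps)
  define Z where "Z = of_real X' * (1 + \<i>)"
  define z where "z = of_real X' * (1 - \<i>)"
  have e4: "exp (of_real pi * \<i> / 4) = (1 + \<i>) / of_real (sqrt 2)"
    "exp (- (of_real pi * \<i> / 4)) = (1 - \<i>) / of_real (sqrt 2)"
    by (auto simp: complex_eq_iff Re_exp Im_exp cos_45 sin_45 real_div_sqrt field_simps)
  have Zz: "of_real X * exp (of_real pi * \<i> / 4) = Z" "of_real X * exp (- (of_real pi * \<i> / 4)) = z"
    unfolding e4 by (simp_all add: Z_def z_def X'_def)
  have Re: "Re Z > 0" "Re z > 0" using X' by (simp_all add: Z_def z_def)
  define F where "F = (\<lambda>p q. exp (\<i> * of_real (r * p) - Z * of_real (cosh p)) * exp (\<i> * of_real (r * q) - z * of_real (cosh q)))"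
  have i1: "integrable lborel (\<lambda>p. exp (\<i> * of_real (r * p) - Z * of_real (cosh p)))"
    and i2: "integrable lborel (\<lambda>q. exp (\<i> * of_real (r * q) - z * of_real (cosh q)))"
    by (rule integrable_exp_cosh_complex, rule Re)+
  have iF: "integrable (lborel \<Otimes>\<^sub>M lborel) (case_prod F)"
    unfolding F_def
  proof (rule lborel_pair.Fubini_integrable, goal_cases)
    case 2
    then show ?case using integrable_norm[OF i1] by (simp only: prod.case norm_mult integral_mult_right_zero) simp
  next
    case 3
    then show ?case using i2 by simp
  qed simp
  have inner: "(LINT b|lborel. F (m + b) (m - b)) =
      exp (\<i> * of_real (r * (2 * m))) * of_real (bessel_L (sqrt 2 * X * sqrt (cosh (2 * m))))" for m
  proof -
    define R where "R = sqrt (cosh (2 * m))"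
    \<comment> \<open>Polar coordinates: \<open>R\<close> and \<open>t\<close> are chosen so that R
      cos t = cosh m and R sin t = sinh m, and R^2 = cosh (2 m). Then cosh b cosh m + i sinh b sinh
      m equals R cosh (b + i t).\<close>
    define t where "t = arctan (tanh m)"
    have R2: "R\<^sup>2 = (cosh m)\<^sup>2 + (sinh m)\<^sup>2" by (simp add: R_def cosh_double)
    have Rp: "R > 0" by (simp add: R_def)
    have ct: "cos t = cosh m / R" "sin t = sinh m / R"
    proof -
      have "1 + (tanh m)\<^sup>2 = (R / cosh m)\<^sup>2"
        unfolding power_divide R2 by (simp add: tanh_def field_simps)
      then have "sqrt (1 + (tanh m)\<^sup>2) = R / cosh m"
        using Rp by (simp add: real_sqrt_unique)
      then show "cos t = cosh m / R" "sin t = sinh m / R"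
        by (simp_all add: t_def cos_arctan sin_arctan tanh_def)
    qed
    have t: "\<bar>t\<bar> < pi / 2"
      unfolding t_def using arctan_bounded[of "tanh m"] by auto
    have "F (m + b) (m - b) = exp (\<i> * of_real (r * (2 * m))) *
       exp (- of_real (sqrt 2 * X * R) * (of_real (cosh b * cos t) + \<i> * of_real (sinh b * sin t)))" for b
    proof -
      have "of_real R * (of_real (cosh b * cos t) + \<i> * of_real (sinh b * sin t)) =
          complex_of_real (cosh b * cosh m) + \<i> * of_real (sinh b * sinh m)"
        unfolding ct using Rp by (simp add: field_simps)
      then have "of_real (sqrt 2 * X * R) * (of_real (cosh b * cos t) + \<i> * of_real (sinh b * sin t)) =
          of_real (sqrt 2 * X) * (complex_of_real (cosh b * cosh m) + \<i> * of_real (sinh b * sinh m))"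
        by (simp only: of_real_mult mult.assoc)
      also have "\<dots> = Z * of_real (cosh (m + b)) + z * of_real (cosh (m - b))"
        unfolding X'(2) by (simp add: Z_def z_def cosh_add cosh_diff algebra_simps)
      finally have *: "- of_real (sqrt 2 * X * R) * (of_real (cosh b * cos t) + \<i> * of_real (sinh b * sin t)) =
         - (Z * of_real (cosh (m + b)) + z * of_real (cosh (m - b)))" by simp
      show ?thesis
        unfolding F_def * exp_add[symmetric] by (rule arg_cong[of _ _ exp]) (simp add: algebra_simps)
    qed
    then show ?thesis
      using bessel_L_contour_shift[OF _ t, of "sqrt 2 * X * R"] X Rp by (simp add: R_def)
  qed
  have "bessel_K (\<i> * of_real r) Z * bessel_K (\<i> * of_real r) z = (LINT p|lborel. LINT q|lborel. F p q) / 4"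
    unfolding F_def bessel_K_integral[OF Re(1)] bessel_K_integral[OF Re(2)] by simp
  also have "\<dots> = (LINT m|lborel. LINT b|lborel. F (m + b) (m - b)) / 2"
    using integral_hyperbolic_rotation[OF iF] lborel_pair.Fubini_integral[OF integrable_hyperbolic_rotation[OF iF]]
    by (simp add: scaleR_conv_of_real field_simps)
  \<comment> \<open>Passing from m to y = 2 m turns the denominator 2 into 4 and the phase into exp
    (i r y).\<close>
  also have "\<dots> = (LINT y|lborel. exp (\<i> * of_real (r * y)) * of_real (bessel_L (sqrt 2 * X * sqrt (cosh y)))) / 4"
    unfolding inner
    by (subst (2) lborel_integral_real_affine[of 2 _ 0]) (simp_all add: scaleR_conv_of_real)
  finally show ?thesis unfolding Zz .
qed

text \<open>The sum of squares factors as (ker + i kei) (ker - i kei), and the two exponential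
  prefactors of the defining equations are reciprocal. The argument comes from sqrt 2 * 2 (4
  x)^(1/4) = 4 x^(1/4).\<close>

lemma kelvin_kernel_eq:
  assumes x: "x > 0"
  shows "kelvin_kernel x \<tau> =
    (LINT y|lborel. exp (\<i> * of_real (2 * \<tau> * y)) * of_real (bessel_L (4 * x powr (1/4) * sqrt (cosh y)))) / 4"
proof -
  define X where "X = 2 * (4 * x) powr (1/4)"
  define \<nu> where "\<nu> = 2 * \<i> * complex_of_real \<tau>"
  have \<nu>: "\<nu> = \<i> * of_real (2 * \<tau>)" by (simp add: \<nu>_def)
  have X: "X > 0" using x by (simp add: X_def)
  have "4 powr (1/4) = sqrt (2::real)"
    using powr_powr[of 2 2 "1/4::real"] by (simp add: powr_half_sqrt)
  then have sX: "sqrt 2 * X = 4 * x powr (1/4)"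
    using x by (simp add: X_def powr_mult algebra_simps)
  have "kelvin_kernel x \<tau> = (kelvin_ker \<nu> X + \<i> * kelvin_kei \<nu> X) * (kelvin_ker \<nu> X - \<i> * kelvin_kei \<nu> X)"
    by (simp add: kelvin_kernel_def X_def \<nu>_def power2_eq_square algebra_simps)
  also have "\<dots> = exp (- \<nu> * of_real pi * \<i> / 2) * exp (\<nu> * of_real pi * \<i> / 2) *
     (bessel_K \<nu> (of_real X * exp (of_real pi * \<i> / 4)) * bessel_K \<nu> (of_real X * exp (- (of_real pi * \<i> / 4))))"
    unfolding kelvin_ker_kei_plus kelvin_ker_kei_minus by (simp only: mult_ac)
  also have "exp (- \<nu> * of_real pi * \<i> / 2) * exp (\<nu> * of_real pi * \<i> / 2) = 1"
    by (simp flip: exp_add)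
  finally show ?thesis
    unfolding \<nu> bessel_K_conjugate_product[OF X] sX by simp
qed

section \<open>Bounds uniform in \<tau> and continuity of the kernel\<close>

text \<open>This is \<open>bessel_L_bound\<close> with exponent 4 \<gamma>, the one that yields
  x^(-\<gamma>). From 4^(-4 \<gamma>) = 256^(-\<gamma>) a factor 4^(-\<gamma>) is moved into the
  power of 2 cosh y, whose integral is known to be
  \<open>Beta \<gamma> \<gamma> / 2\<close>.\<close>

definition kelvin_majorant :: "real \<Rightarrow> real \<Rightarrow> real \<Rightarrow> real" where
  "kelvin_majorant \<gamma> x y = Gamma (4 * \<gamma>) * 64 powr (- \<gamma>) * x powr (- \<gamma>) * (2 * cosh y) powr (- 2 * \<gamma>)"

lemma bessel_L_le_kelvin_majorant:
  assumes "\<gamma> > 0" "x > 0"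
  shows "bessel_L (4 * x powr (1/4) * sqrt (cosh y)) \<le> kelvin_majorant \<gamma> x y"
proof -
  define w where "w = 4 * x powr (1/4) * sqrt (cosh y)"
  have w: "w > 0" using assms by (simp add: w_def)
  have "w powr (4 * \<gamma>) * bessel_L w \<le> Gamma (4 * \<gamma>)"
    by (rule bessel_L_bound) (use assms w in auto)
  then have "bessel_L w \<le> Gamma (4 * \<gamma>) * w powr (- (4 * \<gamma>))"
    using w by (simp add: powr_minus field_simps)
  also have "w powr (- (4 * \<gamma>)) = 64 powr (- \<gamma>) * x powr (- \<gamma>) * (2 * cosh y) powr (- 2 * \<gamma>)"
  proof -
    have "w powr (- (4 * \<gamma>)) = 4 powr (- (4 * \<gamma>)) * x powr (- \<gamma>) * cosh y powr (- 2 * \<gamma>)"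
      using assms by (simp add: w_def powr_mult powr_powr flip: powr_half_sqrt)
    moreover have "(4::real) powr (- (4 * \<gamma>)) = 64 powr (- \<gamma>) * 2 powr (- 2 * \<gamma>)"
      using powr_powr[of 2 2 "- (4 * \<gamma>)"] powr_powr[of 2 6 "- \<gamma>"] by (simp flip: powr_add)
    ultimately show ?thesis by (simp add: powr_mult)
  qed
  finally show ?thesis by (simp add: w_def kelvin_majorant_def mult_ac)
qed

lemma
  assumes "\<gamma> > 0"
  shows integrable_kelvin_majorant: "integrable lborel (kelvin_majorant \<gamma> x)"
    and integral_kelvin_majorant: "(LINT y|lborel. kelvin_majorant \<gamma> x y)
      = Gamma (4 * \<gamma>) * 64 powr (- \<gamma>) * Beta \<gamma> \<gamma> / 2 * x powr (- \<gamma>)"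
proof -
  let ?s = "of_real \<gamma> :: complex"
  have e: "exp (- 2 * ?s * of_real (ln (2 * cosh b))) = of_real ((2 * cosh b) powr (- 2 * \<gamma>))" for b
    by (simp add: powr_def flip: exp_of_real)
  have i: "integrable lborel (\<lambda>b. (2 * cosh b) powr (- 2 * \<gamma>))"
    using integrable_norm[OF integrable_cosh_powr[of ?s]] assms unfolding e by simp
  then show "integrable lborel (kelvin_majorant \<gamma> x)"
    unfolding kelvin_majorant_def[abs_def] by simp
  have "2 * Gamma (2 * ?s) * of_real (LINT b|lborel. (2 * cosh b) powr (- 2 * \<gamma>)) = Gamma ?s * Gamma ?s"
    using Fourier_cosh_powr[of ?s 0] assms unfolding e by (simp add: integral_complex_of_real del: of_real_mult)
  then have "complex_of_real (2 * Gamma (2 * \<gamma>) * (LINT b|lborel. (2 * cosh b) powr (- 2 * \<gamma>))) = of_real (Gamma \<gamma> * Gamma \<gamma>)"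
    using Gamma_complex_of_real[of "2 * \<gamma>"] by (simp add: Gamma_complex_of_real)
  then have "2 * Gamma (2 * \<gamma>) * (LINT b|lborel. (2 * cosh b) powr (- 2 * \<gamma>)) = Gamma \<gamma> * Gamma \<gamma>"
    by (simp only: of_real_eq_iff)
  moreover have "Gamma (2 * \<gamma>) > 0" using assms by (intro Gamma_real_pos) simp
  ultimately have "(LINT b|lborel. (2 * cosh b) powr (- 2 * \<gamma>)) = Beta \<gamma> \<gamma> / 2"
    by (simp add: Beta_def field_simps)
  then show "(LINT y|lborel. kelvin_majorant \<gamma> x y)
      = Gamma (4 * \<gamma>) * 64 powr (- \<gamma>) * Beta \<gamma> \<gamma> / 2 * x powr (- \<gamma>)"
    unfolding kelvin_majorant_def[abs_def] by simp
qed

lemma integrable_kelvin_kernel_integrand: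
  assumes "x > 0"
  shows "integrable lborel (\<lambda>y. exp (\<i> * of_real (2 * \<tau> * y)) * of_real (bessel_L (4 * x powr (1/4) * sqrt (cosh y))))"
proof (rule Bochner_Integration.integrable_bound[OF integrable_kelvin_majorant[of 1 x]])
  show "AE y in lborel. norm (exp (\<i> * of_real (2 * \<tau> * y)) * of_real (bessel_L (4 * x powr (1/4) * sqrt (cosh y))))
      \<le> norm (kelvin_majorant 1 x y)"
    using bessel_L_le_kelvin_majorant[of 1 x] bessel_L_nonneg assms
    by (intro AE_I2) (auto simp: norm_mult intro: order_trans[OF _ abs_ge_self])
qed simp_all

text \<open>Only the phase carries \<tau>, and it has modulus 1. The constant on the right is
  \<open>kelvin_bound \<gamma>\<close> with its Gamma integral evaluated.\<close>

lemma norm_kelvin_kernel_le: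
  assumes "\<gamma> > 0" "x > 0"
  shows "norm (kelvin_kernel x \<tau>) \<le> Gamma (4 * \<gamma>) * 64 powr (- \<gamma>) * Beta \<gamma> \<gamma> / 8 * x powr (- \<gamma>)"
proof -
  have "norm (LINT y|lborel. exp (\<i> * of_real (2 * \<tau> * y)) * of_real (bessel_L (4 * x powr (1/4) * sqrt (cosh y))))
     \<le> (LINT y|lborel. kelvin_majorant \<gamma> x y)"
  proof (rule Bochner_Integration.integral_norm_bound_integral)
    show "integrable lborel (\<lambda>y. exp (\<i> * of_real (2 * \<tau> * y)) * of_real (bessel_L (4 * x powr (1/4) * sqrt (cosh y))))"
      by (rule integrable_kelvin_kernel_integrand[OF assms(2)])
    show "integrable lborel (kelvin_majorant \<gamma> x)"
      by (rule integrable_kelvin_majorant[OF assms(1)])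
    show "norm (exp (\<i> * of_real (2 * \<tau> * y)) * of_real (bessel_L (4 * x powr (1/4) * sqrt (cosh y)))) \<le> kelvin_majorant \<gamma> x y" for y
      using bessel_L_le_kelvin_majorant[OF assms] bessel_L_nonneg by (simp add: norm_mult)
  qed
  then show ?thesis
    unfolding kelvin_kernel_eq[OF assms(2)] integral_kelvin_majorant[OF assms(1)] by (simp add: norm_divide)
qed


lemma isCont_bessel_L:
  assumes "w > 0"
  shows "isCont bessel_L w"
  using isCont_Re[OF isCont_bessel_F[OF assms, of 0]] unfolding bessel_F_0 by simp

lemma isCont_kelvin_kernel:
  assumes x: "x > 0"
  shows "isCont (\<lambda>x. kelvin_kernel x \<tau>) x"
proof -
  have "isCont (\<lambda>x. LINT y|lborel. exp (\<i> * of_real (2 * \<tau> * y)) * of_real (bessel_L (4 * x powr (1/4) * sqrt (cosh y)))) x"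
  proof (rule isCont_integral_dominated)
    show "open {x / 2<..}" "x \<in> {x / 2<..}" using x by auto
    \<comment> \<open>The majorant decreases in its first argument, so its value at x / 2 dominates
      on the whole neighbourhood; the exponent 1 is an arbitrary positive choice.\<close>
    show "integrable lborel (kelvin_majorant 1 (x / 2))"
      by (rule integrable_kelvin_majorant) simp
    fix y
    have L: "isCont bessel_L (4 * x powr (1/4) * sqrt (cosh y))"
      by (rule isCont_bessel_L) (use x in auto)
    have "isCont (\<lambda>x. 4 * x powr (1/4) * sqrt (cosh y)) x"
      by (intro continuous_intros) (use x in auto)
    from isCont_o2[OF this L]
    have L': "isCont (\<lambda>x. bessel_L (4 * x powr (1/4) * sqrt (cosh y))) x" .
    show "isCont (\<lambda>x. exp (\<i> * of_real (2 * \<tau> * y)) * of_real (bessel_L (4 * x powr (1/4) * sqrt (cosh y)))) x"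
      by (intro continuous_intros L')
    fix u assume u: "u \<in> {x / 2<..}"
    have "bessel_L (4 * u powr (1/4) * sqrt (cosh y)) \<le> kelvin_majorant 1 u y"
      by (rule bessel_L_le_kelvin_majorant) (use x u in auto)
    also have "\<dots> \<le> kelvin_majorant 1 (x / 2) y"
      unfolding kelvin_majorant_def using x u
      by (intro mult_right_mono mult_left_mono powr_mono2') (auto intro!: Gamma_real_nonneg)
    finally show "norm (exp (\<i> * of_real (2 * \<tau> * y)) * of_real (bessel_L (4 * u powr (1/4) * sqrt (cosh y)))) \<le> kelvin_majorant 1 (x / 2) y"
      using bessel_L_nonneg by (simp add: norm_mult)
  qed simp
  then have "isCont (\<lambda>x. (LINT y|lborel. exp (\<i> * of_real (2 * \<tau> * y)) * of_real (bessel_L (4 * x powr (1/4) * sqrt (cosh y)))) / 4) x"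
    by (intro continuous_intros) auto
  moreover have "eventually (\<lambda>x. kelvin_kernel x \<tau> = (LINT y|lborel. exp (\<i> * of_real (2 * \<tau> * y)) *
      of_real (bessel_L (4 * x powr (1/4) * sqrt (cosh y)))) / 4) (nhds x)"
    by (rule eventually_mono[OF eventually_nhds_in_open[of "{0<..}"]]) (use x kelvin_kernel_eq in auto)
  ultimately show ?thesis
    by (subst isCont_cong)
qed

section \<open>The constant and the Mellin transform of the kernel\<close>

text \<open>The reciprocal \<open>rGamma\<close> is entire, and \<open>inverse 0 = 0\<close>
  supplies the value of \<open>Gamma\<close> at its poles.\<close>

lemma borel_measurable_Gamma [measurable]: "(Gamma :: complex \<Rightarrow> complex) \<in> borel_measurable borel"
proof -
  have "(rGamma :: complex \<Rightarrow> complex) \<in> borel_measurable borel"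
    by (intro borel_measurable_continuous_onI continuous_intros)
  then have "(\<lambda>z::complex. inverse (rGamma z)) \<in> borel_measurable borel"
    by measurable
  then show ?thesis by (simp add: Gamma_def[abs_def])
qed

lemma borel_measurable_Complex [measurable]: "Complex a \<in> borel_measurable borel"
  unfolding Complex_eq[abs_def] by measurable

section \<open>Gamma on vertical lines and the value of the constant\<close>

lemma norm_Gamma_le:
  assumes "Re s > 0"
  shows "norm (Gamma s) \<le> Gamma (Re s)"
proof -
  have "norm (LINT p|lborel. exp (s * of_real p - of_real (1 * exp p))) \<le> (LINT p|lborel. exp (Re s * p - 1 * exp p))"
    by (rule order_trans[OF integral_norm_bound]) (simp add: norm_exp_eq_Re)
  then show ?thesis
    using integral_Gamma_exp[of s 1] integral_Gamma_exp_real[of "Re s" 1] assms by simp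
qed

text \<open>The functional equation trades one unit of real part for a factor 1 / |s|; the square of
  this is integrable along the line.\<close>

lemma norm_Gamma_line_le:
  assumes a: "a > 0"
  shows "(norm (Gamma (Complex a t)))\<^sup>2 \<le> (Gamma (a + 1))\<^sup>2 * (1 / (a\<^sup>2 + t\<^sup>2))"
proof -
  have "Gamma (Complex a t + 1) = Complex a t * Gamma (Complex a t)"
    by (rule Gamma_plus1, rule Re_pos_not_nonpos_Ints) (use a in simp)
  then have "norm (Complex a t) * norm (Gamma (Complex a t)) = norm (Gamma (Complex a t + 1))"
    by (simp add: norm_mult)
  also have "\<dots> \<le> Gamma (a + 1)"
    using norm_Gamma_le[of "Complex a t + 1"] a by simp
  finally have "(norm (Complex a t) * norm (Gamma (Complex a t)))\<^sup>2 \<le> (Gamma (a + 1))\<^sup>2"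
    by (intro power_mono) auto
  then have "(a\<^sup>2 + t\<^sup>2) * (norm (Gamma (Complex a t)))\<^sup>2 \<le> (Gamma (a + 1))\<^sup>2"
    by (simp add: power_mult_distrib complex_norm)
  moreover have "a\<^sup>2 + t\<^sup>2 > 0" using a by (intro add_pos_nonneg) auto
  ultimately show ?thesis by (simp add: field_simps)
qed

lemma integrable_inverse_square_sum:
  fixes a :: real
  assumes "a > 0"
  shows "integrable lborel (\<lambda>t. 1 / (a\<^sup>2 + t\<^sup>2))"
proof -
  have "integrable lborel (\<lambda>x::real. inverse (1 + x\<^sup>2))"
    using integrable_inverse_1_plus_square by (simp add: set_integrable_def)
  from lborel_integrable_real_affine[OF this, of "1 / a" 0]
  have "integrable lborel (\<lambda>t. inverse (1 + (t / a)\<^sup>2))" using assms by simp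
  then have "integrable lborel (\<lambda>t. 1 / a\<^sup>2 * inverse (1 + (t / a)\<^sup>2))" by (rule integrable_mult_right)
  moreover have "1 / a\<^sup>2 * inverse (1 + (t / a)\<^sup>2) = 1 / (a\<^sup>2 + t\<^sup>2)" for t
    using assms by (simp add: field_simps power_divide)
  ultimately show ?thesis by simp
qed

text \<open>By \<open>Fourier_cosh_powr\<close> the squared modulus is, in t, the Fourier transform
  of y \<mapsto> Gamma (2 a) (2 cosh (y / 2))^(-2 a). Inversion at y = 0 gives 2 pi times the value
  4^(-a) Gamma (2 a) there.\<close>

lemma
  assumes a: "a > 0"
  shows integrable_norm_Gamma_square: "integrable lborel (\<lambda>t. (norm (Gamma (Complex a t)))\<^sup>2)"
    and integral_norm_Gamma_square: "(LINT t|lborel. (norm (Gamma (Complex a t)))\<^sup>2) = 2 * pi * 4 powr (- a) * Gamma (2 * a)"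
proof -
  show i: "integrable lborel (\<lambda>t. (norm (Gamma (Complex a t)))\<^sup>2)"
  proof (rule Bochner_Integration.integrable_bound)
    show "integrable lborel (\<lambda>t. (Gamma (a + 1))\<^sup>2 * (1 / (a\<^sup>2 + t\<^sup>2)))"
      by (rule integrable_mult_right, rule integrable_inverse_square_sum[OF a])
    show "AE t in lborel. norm ((norm (Gamma (Complex a t)))\<^sup>2) \<le> norm ((Gamma (a + 1))\<^sup>2 * (1 / (a\<^sup>2 + t\<^sup>2)))"
      using norm_Gamma_line_le[OF a] by (intro AE_I2) (auto intro: order_trans[OF _ abs_ge_self])
  qed simp
  define h where "h = (\<lambda>b. exp (- 2 * of_real a * of_real (ln (2 * cosh b))) :: complex)"
  define f where "f = (\<lambda>y. Gamma (2 * of_real a) * h (y / 2))"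
  have ih: "integrable lborel h"
    unfolding h_def by (rule integrable_cosh_powr) (use a in simp)
  have nh: "norm (h b) \<le> 1" for b
  proof -
    have "0 \<le> ln (2 * cosh b)" using cosh_real_ge_1[of b] by simp
    then show ?thesis using a by (simp add: h_def)
  qed
  have F: "complex_of_real ((norm (Gamma (Complex a t)))\<^sup>2) = (LINT y|lborel. exp (\<i> * of_real (t * y)) * f y)" for t
  proof -
    have "(LINT y|lborel. exp (\<i> * of_real (t * y)) * f y) = 2 * Gamma (2 * of_real a) *
        (LINT b|lborel. exp (\<i> * of_real (2 * t * b)) * h b)"
      by (subst lborel_integral_real_affine[of 2 _ 0])
        (simp_all add: f_def scaleR_conv_of_real mult_ac flip: integral_mult_right_zero)
    also have "\<dots> = Gamma (of_real a + \<i> * of_real (2 * t) / 2) * Gamma (of_real a - \<i> * of_real (2 * t) / 2)"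
      unfolding h_def by (rule Fourier_cosh_powr) (use a in simp)
    also have "of_real a + \<i> * of_real (2 * t) / 2 = Complex a t" by (simp add: complex_eq_iff)
    also have "of_real a - \<i> * of_real (2 * t) / 2 = cnj (Complex a t)" by (simp add: complex_eq_iff)
    finally show ?thesis by (simp only: complex_norm_square cnj_Gamma)
  qed
  have "(LINT t|lborel. complex_of_real ((norm (Gamma (Complex a t)))\<^sup>2) * exp (- \<i> * of_real (t * 0))) = 2 * of_real pi * f 0"
  proof (rule Fourier_inversion_at)
    show "integrable lborel f"
      unfolding f_def using lborel_integrable_real_affine[OF ih, of "1 / 2" 0] by simp
    show "norm (f y) \<le> norm (Gamma (2 * complex_of_real a))" for y
      using nh[of "y / 2"] by (simp add: f_def norm_mult mult_left_le)
    show "isCont f 0"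
      unfolding f_def h_def by (intro continuous_intros) auto
    show "integrable lborel (\<lambda>t. complex_of_real ((norm (Gamma (Complex a t)))\<^sup>2))"
      using i by (rule integrable_of_real)
  qed (rule F)
  then have "complex_of_real (LINT t|lborel. (norm (Gamma (Complex a t)))\<^sup>2) = 2 * of_real pi * f 0"
    by (simp only: of_real_0 mult_zero_right exp_zero mult_1_right integral_complex_of_real)
  also have "\<dots> = of_real (2 * pi * 4 powr (- a) * Gamma (2 * a))"
  proof -
    have "4 powr (- a) = exp (- 2 * a * ln 2)"
      using ln_realpow[of 2 2] by (simp add: powr_def)
    then show ?thesis
      using Gamma_complex_of_real[of "2 * a"] by (simp add: f_def h_def flip: exp_of_real)
  qed
  finally show "(LINT t|lborel. (norm (Gamma (Complex a t)))\<^sup>2) = 2 * pi * 4 powr (- a) * Gamma (2 * a)"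
    by (simp only: of_real_eq_iff)
qed

text \<open>The Parseval identity is taken at a = 2 \<gamma>; doubling s halves the integral, and
  4^(-\<gamma>) 4^(-2 \<gamma>) = 64^(-\<gamma>).\<close>

lemma kelvin_bound_eq:
  assumes "\<gamma> > 0"
  shows "kelvin_bound \<gamma> = Gamma (4 * \<gamma>) * 64 powr (- \<gamma>) * Beta \<gamma> \<gamma> / 8"
proof -
  have "vline_abs_integral \<gamma> (\<lambda>s. (Gamma (2 * s))\<^sup>2) = (LINT t|lborel. (norm (Gamma (Complex (2 * \<gamma>) (2 * t))))\<^sup>2)"
  proof -
    have "2 * Complex \<gamma> t = Complex (2 * \<gamma>) (2 * t)" for t by (simp add: complex_eq_iff)
    then show ?thesis
      unfolding vline_abs_integral_def by (subst integral_completion) (simp_all add: norm_power)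
  qed
  also have "\<dots> = pi * 4 powr (- (2 * \<gamma>)) * Gamma (4 * \<gamma>)"
    using lborel_integral_real_affine[of 2 "\<lambda>t. (norm (Gamma (Complex (2 * \<gamma>) t)))\<^sup>2" 0]
      integral_norm_Gamma_square[of "2 * \<gamma>"] assms by simp
  also have "(4::real) powr (- (2 * \<gamma>)) = 64 powr (- \<gamma>) / 4 powr (- \<gamma>)"
    using powr_mult[of 16 4 "- \<gamma>"] powr_powr[of 4 2 "- \<gamma>"] by simp
  finally show ?thesis unfolding kelvin_bound_def by simp
qed

text \<open>In the Fourier representation of the kernel the p-integral is a Mellin transform of K_0,
  where \<open>cosh y\<close> enters only as a scaling and comes out as (2 cosh y)^(-2 s). The
  y-integral that remains is \<open>Fourier_cosh_powr\<close>, and one of the two factors Gamma (2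
  s) in \<open>M\<close> is used up there.\<close>

lemma
  fixes s :: complex
  assumes s: "Re s > 0"
  shows integrable_Mellin_kernel_integrand: "integrable (lborel \<Otimes>\<^sub>M lborel) (\<lambda>(y, p). exp (s * of_real p) *
      (exp (\<i> * of_real (2 * \<tau> * y)) * of_real (bessel_L (4 * exp p powr (1/4) * sqrt (cosh y)))))"
    and Mellin_kelvin_kernel: "(LINT p|lborel. exp (s * of_real p) * kelvin_kernel (exp p) \<tau>)
      = exp (- s * of_real (ln 4)) / 4 * Gamma (2 * s) * (Gamma (s + \<i> * of_real \<tau>) * Gamma (s - \<i> * of_real \<tau>))"
proof -
  define M where "M = (\<lambda>s::complex. 2 * (Gamma (2 * s))\<^sup>2 * exp (- s * of_real (ln 4)))"
  have inner: "integrable lborel (\<lambda>p. exp (s * of_real p) * of_real (bessel_L (4 * exp p powr (1/4) * sqrt (cosh y))))"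
    "(LINT p|lborel. exp (s * of_real p) * of_real (bessel_L (4 * exp p powr (1/4) * sqrt (cosh y))))
      = M s * exp (- 2 * s * of_real (ln (2 * cosh y)))" if s: "Re s > 0" for s y
  proof -
    let ?f = "\<lambda>p. exp (s * of_real p) * complex_of_real (bessel_L (4 * exp p powr (1/4) * sqrt (cosh y)))"
    \<comment> \<open>Chosen so that p = c + 4 m turns the argument 4 exp (p / 4) sqrt (cosh y) into
      2 exp m.\<close>
    define c where "c = - ln 4 - 2 * ln (2 * cosh y)"
    have f: "?f (c + 4 * m) = exp (s * of_real c) * (exp (2 * (2 * s) * of_real m) * bessel_F 0 (2 * exp m))" for m
    proof -
      have "exp (c + 4 * m) powr (1/4) = exp m * exp (c / 4)"
        by (simp add: powr_def field_simps flip: exp_add)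
      moreover have "exp (c / 4) * sqrt (cosh y) = 1 / 2"
      proof -
        have "sqrt (cosh y) = exp (ln (cosh y) / 2)"
          by (simp add: exp_ln powr_half_sqrt[symmetric] powr_def)
        then have "exp (c / 4) * sqrt (cosh y) = exp (c / 4 + ln (cosh y) / 2)"
          by (simp add: exp_add)
        also have "c / 4 + ln (cosh y) / 2 = - ln 2"
          using ln_realpow[of 2 2] by (simp add: c_def ln_mult field_simps)
        finally show ?thesis by (simp add: exp_minus)
      qed
      ultimately have "4 * exp (c + 4 * m) powr (1/4) * sqrt (cosh y) = 4 * (exp m * (1 / 2))"
        by (simp only: mult.assoc)
      then have e: "4 * exp (c + 4 * m) powr (1/4) * sqrt (cosh y) = 2 * exp m" by simp
      show ?thesis
        unfolding e bessel_F_0 by (simp add: algebra_simps flip: exp_add)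
    qed
    have i: "integrable lborel (\<lambda>m. exp (2 * (2 * s) * of_real m) * bessel_F 0 (2 * exp m))"
      by (rule integrable_Mellin_bessel_F) (use s in simp)
    have "integrable lborel (\<lambda>m. ?f (c + 4 * m))"
      unfolding f by (rule integrable_mult_right[OF i])
    then show "integrable lborel ?f"
      by (subst (asm) lborel_integrable_real_affine_iff) auto
    have "(LINT p|lborel. ?f p) = 4 * (exp (s * of_real c) * (LINT m|lborel. exp (2 * (2 * s) * of_real m) * bessel_F 0 (2 * exp m)))"
      by (subst lborel_integral_real_affine[of 4 _ c]) (simp_all only: f integral_mult_right_zero, simp_all add: scaleR_conv_of_real)
    also have "\<dots> = M s * exp (- 2 * s * of_real (ln (2 * cosh y)))"
      using Mellin_bessel_F[of "2 * s" 0] s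
      by (simp add: M_def c_def power2_eq_square algebra_simps flip: exp_add)
    finally show "(LINT p|lborel. ?f p) = M s * exp (- 2 * s * of_real (ln (2 * cosh y)))" .
  qed
  define H where "H = (\<lambda>y p. exp (s * of_real p) *
      (exp (\<i> * of_real (2 * \<tau> * y)) * complex_of_real (bessel_L (4 * exp p powr (1/4) * sqrt (cosh y)))))"
  have H: "H y p = exp (\<i> * of_real (2 * \<tau> * y)) *
      (exp (s * of_real p) * complex_of_real (bessel_L (4 * exp p powr (1/4) * sqrt (cosh y))))" for y p
    by (simp add: H_def mult_ac)
  have iH: "integrable (lborel \<Otimes>\<^sub>M lborel) (case_prod H)"
  proof (rule lborel_pair.Fubini_integrable)
    show "case_prod H \<in> borel_measurable (lborel \<Otimes>\<^sub>M lborel)"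
      unfolding H_def by measurable
    show "AE y in lborel. integrable lborel (\<lambda>p. case (y, p) of (y, p) \<Rightarrow> H y p)"
      using inner(1)[OF s] by (simp add: H)
    \<comment> \<open>Since \<open>bessel_L\<close> is nonnegative, the modulus is the same
      integrand at the real point \<open>Re s\<close> without phase, so its integral is again given
      by \<open>inner\<close>.\<close>
    have "(LINT p|lborel. norm (H y p)) = norm (M (Re s) * exp (- 2 * of_real (Re s) * of_real (ln (2 * cosh y))))" for y
    proof -
      have "complex_of_real (LINT p|lborel. norm (H y p)) = (LINT p|lborel. exp (of_real (Re s) * of_real p) *
          of_real (bessel_L (4 * exp p powr (1/4) * sqrt (cosh y))))"
        unfolding integral_complex_of_real[symmetric]
        by (rule Bochner_Integration.integral_cong) (simp_all add: H_def norm_mult bessel_L_nonneg exp_of_real[symmetric])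
      also have "\<dots> = M (Re s) * exp (- 2 * of_real (Re s) * of_real (ln (2 * cosh y)))"
        by (rule inner(2)) (use s in simp)
      finally show ?thesis
        by (metis Bochner_Integration.integral_nonneg norm_ge_zero norm_of_real abs_of_nonneg)
    qed
    moreover have "integrable lborel (\<lambda>y. norm (M (Re s) * exp (- 2 * of_real (Re s) * of_real (ln (2 * cosh y)))))"
      by (intro integrable_norm integrable_mult_right integrable_cosh_powr) (use s in simp)
    ultimately show "integrable lborel (\<lambda>y. LINT p|lborel. norm (case (y, p) of (y, p) \<Rightarrow> H y p))"
      by (simp only: prod.case)
  qed
  then show "integrable (lborel \<Otimes>\<^sub>M lborel) (\<lambda>(y, p). exp (s * of_real p) *
      (exp (\<i> * of_real (2 * \<tau> * y)) * of_real (bessel_L (4 * exp p powr (1/4) * sqrt (cosh y)))))"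
    by (simp only: H_def)
  have "(LINT p|lborel. exp (s * of_real p) * kelvin_kernel (exp p) \<tau>) = (LINT p|lborel. LINT y|lborel. H y p) / 4"
    by (simp add: kelvin_kernel_eq H_def)
  also have "(LINT p|lborel. LINT y|lborel. H y p) = (LINT y|lborel. LINT p|lborel. H y p)"
    by (rule lborel_pair.Fubini_integral[OF iH])
  also have "\<dots> = M s * (LINT y|lborel. exp (\<i> * of_real (2 * \<tau> * y)) * exp (- 2 * s * of_real (ln (2 * cosh y))))"
    unfolding H integral_mult_right_zero inner(2)[OF s]
    by (simp only: integral_mult_right_zero[symmetric] mult_ac)
  also have "\<dots> = exp (- s * of_real (ln 4)) * Gamma (2 * s) * (Gamma (s + \<i> * of_real \<tau>) * Gamma (s - \<i> * of_real \<tau>))"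
    using Fourier_cosh_powr[OF s, of "2 * \<tau>"] by (simp add: M_def power2_eq_square mult.assoc)
  finally show "(LINT p|lborel. exp (s * of_real p) * kelvin_kernel (exp p) \<tau>)
      = exp (- s * of_real (ln 4)) / 4 * Gamma (2 * s) * (Gamma (s + \<i> * of_real \<tau>) * Gamma (s - \<i> * of_real \<tau>))"
    by simp
qed

section \<open>A Weber-type integral of Bessel functions\<close>

lemma
  fixes a :: real
  assumes "a > 0"
  shows integrable_Gaussian: "integrable lborel (\<lambda>t. exp (- (a * t\<^sup>2)))"
    and integral_Gaussian: "(LINT t|lborel. exp (- (a * t\<^sup>2))) = sqrt (pi / a)"
proof -
  define e where "e = sqrt (2 * a)"
  have e: "e > 0" using assms by (simp add: e_def)
  have eq: "exp (\<i> * of_real (0 * t) - of_real ((e * t)\<^sup>2 / 2)) = complex_of_real (exp (- (a * t\<^sup>2)))" for t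
    using assms by (simp add: e_def power_mult_distrib flip: exp_of_real)
  show "integrable lborel (\<lambda>t. exp (- (a * t\<^sup>2)))"
    using integrable_norm[OF integral_Gaussian_exp(1)[OF e, of 0]] unfolding eq by simp
  have "complex_of_real (LINT t|lborel. exp (- (a * t\<^sup>2))) = of_real (sqrt (2 * pi) / e)"
    using integral_Gaussian_exp(2)[OF e, of 0] unfolding eq integral_complex_of_real by simp
  then show "(LINT t|lborel. exp (- (a * t\<^sup>2))) = sqrt (pi / a)"
    unfolding of_real_eq_iff by (simp add: e_def real_sqrt_divide real_sqrt_mult)
qed

text \<open>Write \<open>1 / (C\<^sup>2 + p\<^sup>2)\<close> as an Euler integral over \<open>u = exp r > 0\<close>, integrate out \<open>p\<close>, and
  substitute \<open>exp (q / 2) = C (sqrt (y + u) - sqrt y)\<close>.\<close>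

lemma
  fixes y C :: real
  assumes y: "y > 0" and C: "C > 0"
  shows integrable_half_Gaussian: "integrable lborel (\<lambda>q. exp (q / 2 - exp q - 2 * sqrt y * C * exp (q / 2)))"
    and integral_half_Gaussian: "(LINT q|lborel. exp (q / 2 - exp q - 2 * sqrt y * C * exp (q / 2)))
      = C / sqrt pi * (LINT p|lborel. exp (- (y * p\<^sup>2)) / (C\<^sup>2 + p\<^sup>2))"
proof -
  define f where "f = (\<lambda>q. exp (q / 2 - exp q - 2 * sqrt y * C * exp (q / 2)))"
  define u where "u = (\<lambda>r. C * (sqrt (y + exp r) - sqrt y))"
  define h where "h = (\<lambda>r. 2 * ln (u r))"
  define h' where "h' = (\<lambda>r. exp r / (sqrt (y + exp r) * (sqrt (y + exp r) - sqrt y)))"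
  have d: "sqrt (y + exp r) - sqrt y > 0" for r by simp
  have u: "u r > 0" for r using d[of r] C by (simp add: u_def)
  have sq: "sqrt (y + exp r) > 0" for r using y by (simp add: add_pos_pos)
  have h'_pos: "h' r > 0" for r using d[of r] sq[of r] by (simp add: h'_def)
  have fh: "\<bar>h' r\<bar> *\<^sub>R f (h r) = C * (exp (1 * r - C\<^sup>2 * exp r) / sqrt (y + exp r))" for r
  proof -
    have e: "exp (h r / 2) = u r" "exp (h r) = (u r)\<^sup>2"
      using u[of r] by (simp_all add: h_def exp_double)
    \<comment> \<open>Completing the square: adding C^2 y gives C^2 (y + exp r), so the exponent is
      linear in exp r after the substitution.\<close>
    have "(u r)\<^sup>2 + 2 * sqrt y * C * u r = C\<^sup>2 * ((sqrt (y + exp r))\<^sup>2 - (sqrt y)\<^sup>2)"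
      by (simp add: u_def power2_eq_square algebra_simps)
    also have "\<dots> = C\<^sup>2 * exp r" using y by (simp add: add_nonneg_nonneg)
    finally have "f (h r) = u r * exp (- (C\<^sup>2 * exp r))"
      unfolding f_def e exp_diff e exp_minus by (simp add: field_simps flip: exp_add e)
    moreover have "exp (1 * r - C\<^sup>2 * exp r) = exp r * exp (- (C\<^sup>2 * exp r))"
      by (simp flip: exp_add)
    moreover have "h' r * (u r * X) = C * (exp r * X / sqrt (y + exp r))" for X
    proof -
      define D where "D = sqrt (y + exp r) - sqrt y"
      have "D > 0" "h' r = exp r / (sqrt (y + exp r) * D)" "u r = C * D"
        using d[of r] by (simp_all add: D_def h'_def u_def)
      then show ?thesis by simp
    qed
    ultimately show ?thesis
      using h'_pos[of r] by simp
  qed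
  have dh: "(h has_field_derivative h' r) (at r)" for r
  proof -
    have "y + exp r > 0" using y by (simp add: add_pos_pos)
    then have du: "(u has_field_derivative C * (exp r / (2 * sqrt (y + exp r)))) (at r)"
      unfolding u_def by (auto intro!: derivative_eq_intros simp: field_simps)
    define D where "D = sqrt (y + exp r) - sqrt y"
    have "D > 0" "h' r = exp r / (sqrt (y + exp r) * D)" "u r = C * D"
      using d[of r] by (simp_all add: D_def h'_def u_def)
    then have "h' r = 2 * (C * (exp r / (2 * sqrt (y + exp r))) / u r)"
      using C by simp
    then show ?thesis
      unfolding h_def using u[of r] by (auto intro!: derivative_eq_intros du)
  qed
  have inj: "inj h"
  proof (rule injI)
    fix r s assume "h r = h s"
    then have "u r = u s" using u[of r] u[of s] by (simp add: h_def)
    then show "r = s" using C by (simp add: u_def)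
  qed
  have surj: "h ` UNIV = UNIV"
  proof (intro equalityI subsetI UNIV_I)
    fix q
    define v where "v = exp (q / 2) / C + sqrt y"
    have v: "v > sqrt y" using C by (simp add: v_def)
    then have "(sqrt y)\<^sup>2 < v\<^sup>2" using y by (intro power_strict_mono) auto
    then have v2: "exp (ln (v\<^sup>2 - y)) = v\<^sup>2 - y" using y by simp
    have "v \<ge> 0" using v y by (intro less_imp_le order_le_less_trans[OF _ v]) simp
    then have "sqrt (y + exp (ln (v\<^sup>2 - y))) = v"
      unfolding v2 by simp
    then have "u (ln (v\<^sup>2 - y)) = exp (q / 2)" using C by (simp add: u_def v_def)
    then have "q = h (ln (v\<^sup>2 - y))" by (simp add: h_def)
    then show "q \<in> h ` UNIV" by blast
  qed
  note cov = lborel_integral_change_of_variables[of UNIV h UNIV h' f, OF _ surj]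
  have cov1: "integrable lborel (\<lambda>r. C * (exp (1 * r - C\<^sup>2 * exp r) / sqrt (y + exp r))) \<longleftrightarrow> integrable lborel f"
    using cov(1) dh inj unfolding fh by (simp add: set_integrable_def f_def)
  have cov2: "(LINT r|lborel. C * (exp (1 * r - C\<^sup>2 * exp r) / sqrt (y + exp r))) = (LINT q|lborel. f q)"
    using cov(2) dh inj unfolding fh by (simp add: set_lebesgue_integral_def f_def)
  have iC: "integrable lborel (\<lambda>r. exp (1 * r - C\<^sup>2 * exp r))"
    by (rule integrable_Gamma_exp_real) (use C in auto)
  have "integrable lborel (\<lambda>r. 1 / sqrt y * exp (1 * r - C\<^sup>2 * exp r))"
    by (rule integrable_mult_right[OF iC])
  then have "integrable lborel (\<lambda>r. exp (1 * r - C\<^sup>2 * exp r) / sqrt (y + exp r))"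
    by (rule Bochner_Integration.integrable_bound) (use y in \<open>auto intro!: AE_I2 divide_left_mono mult_pos_pos add_pos_pos\<close>)
  then have "integrable lborel (\<lambda>r. C * (exp (1 * r - C\<^sup>2 * exp r) / sqrt (y + exp r)))"
    by (rule integrable_mult_right)
  then show "integrable lborel (\<lambda>q. exp (q / 2 - exp q - 2 * sqrt y * C * exp (q / 2)))"
    unfolding cov1 by (simp add: f_def)
  define G where "G = (\<lambda>p r. exp (- (y * p\<^sup>2)) * exp (1 * r - (C\<^sup>2 + p\<^sup>2) * exp r))"
  have Cp: "C\<^sup>2 + p\<^sup>2 > 0" for p using C by (simp add: add_pos_nonneg)
  have G1: "(LINT r|lborel. G p r) = exp (- (y * p\<^sup>2)) / (C\<^sup>2 + p\<^sup>2)" for p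
    unfolding G_def integral_mult_right_zero using integral_Gamma_exp_real[OF _ Cp[of p], of 1] Cp[of p]
    by (simp add: exp_minus field_simps)
  have G2: "G p r = exp (1 * r - C\<^sup>2 * exp r) * exp (- ((y + exp r) * p\<^sup>2))" for p r
    unfolding G_def exp_add[symmetric] by (simp add: algebra_simps)
  have iG: "integrable (lborel \<Otimes>\<^sub>M lborel) (case_prod G)"
  proof (rule lborel_pair.Fubini_integrable)
    show "case_prod G \<in> borel_measurable (lborel \<Otimes>\<^sub>M lborel)"
      unfolding G_def by measurable
    have "integrable lborel (\<lambda>r. exp (1 * r - (C\<^sup>2 + p\<^sup>2) * exp r))" for p
      by (rule integrable_Gamma_exp_real) (use Cp in auto)
    then show "AE p in lborel. integrable lborel (\<lambda>r. case (p, r) of (p, r) \<Rightarrow> G p r)"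
      by (simp add: G_def)
    have "norm (G p r) = G p r" for p r by (simp add: G_def)
    moreover have "integrable lborel (\<lambda>p. exp (- (y * p\<^sup>2)) / (C\<^sup>2 + p\<^sup>2))"
    proof (rule Bochner_Integration.integrable_bound)
      show "integrable lborel (\<lambda>p. 1 / C\<^sup>2 * exp (- (y * p\<^sup>2)))"
        by (rule integrable_mult_right, rule integrable_Gaussian[OF y])
      show "AE p in lborel. norm (exp (- (y * p\<^sup>2)) / (C\<^sup>2 + p\<^sup>2)) \<le> norm (1 / C\<^sup>2 * exp (- (y * p\<^sup>2)))"
        using C Cp by (intro AE_I2) (auto intro!: divide_left_mono mult_pos_pos)
    qed simp
    ultimately show "integrable lborel (\<lambda>p. LINT r|lborel. norm (case (p, r) of (p, r) \<Rightarrow> G p r))"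
      by (simp add: G1)
  qed
  have "(LINT p|lborel. exp (- (y * p\<^sup>2)) / (C\<^sup>2 + p\<^sup>2)) = (LINT r|lborel. LINT p|lborel. G p r)"
    unfolding G1[symmetric] by (rule lborel_pair.Fubini_integral[OF iG, symmetric])
  also have "\<dots> = (LINT r|lborel. exp (1 * r - C\<^sup>2 * exp r) * sqrt (pi / (y + exp r)))"
    unfolding G2 integral_mult_right_zero using y by (simp add: integral_Gaussian add_pos_pos)
  also have "\<dots> = sqrt pi / C * (LINT r|lborel. C * (exp (1 * r - C\<^sup>2 * exp r) / sqrt (y + exp r)))"
    unfolding integral_mult_right_zero[symmetric] using C by (simp add: real_sqrt_divide mult_ac)
  finally show "(LINT q|lborel. exp (q / 2 - exp q - 2 * sqrt y * C * exp (q / 2)))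
      = C / sqrt pi * (LINT p|lborel. exp (- (y * p\<^sup>2)) / (C\<^sup>2 + p\<^sup>2))"
    unfolding cov2 using C by (simp add: f_def)
qed

lemma change_of_variables_sinh:
  fixes f :: "real \<Rightarrow> real"
  assumes [measurable]: "f \<in> borel_measurable borel"
  shows "integrable lborel (\<lambda>v. cosh v * f (sinh v)) \<longleftrightarrow> integrable lborel f"
    "(LINT v|lborel. cosh v * f (sinh v)) = (LINT p|lborel. f p)"
proof -
  have 1: "sinh ` UNIV = (UNIV :: real set)"
    by (metis surjI sinh_arsinh_real)
  have 2: "inj (sinh :: real \<Rightarrow> real)"
    by (metis injI arsinh_sinh_real)
  have d: "(sinh has_real_derivative cosh x) (at x)" for x :: real
    by (auto intro!: derivative_eq_intros)
  note c = lborel_integral_change_of_variables[of UNIV sinh UNIV cosh f, OF _ 1]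
  show "integrable lborel (\<lambda>v. cosh v * f (sinh v)) \<longleftrightarrow> integrable lborel f"
    using c(1) d 2 by (simp add: set_integrable_def)
  show "(LINT v|lborel. cosh v * f (sinh v)) = (LINT p|lborel. f p)"
    using c(2) d 2 by (simp add: set_lebesgue_integral_def)
qed


text \<open>The case s = 1/2 of \<open>Fourier_cosh_powr\<close>, where the reflection formula
  evaluates Gamma (1/2 + i \<tau>) Gamma (1/2 - i \<tau>). The factor 1 / cosh (pi \<tau>) of the
  theorem originates here.\<close>

lemma Fourier_sech:
  shows "integrable lborel (\<lambda>b::real. 1 / cosh b)"
    and "(LINT b|lborel. exp (\<i> * of_real (2 * \<tau> * b)) * of_real (1 / cosh b)) = of_real (pi / cosh (pi * \<tau>))"
proof -
  have e: "exp (- 2 * (1/2) * complex_of_real (ln (2 * cosh b))) = of_real (1 / cosh b) / 2" for b :: real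
  proof -
    have "exp (- ln (2 * cosh b)) = 1 / cosh b / 2" by (simp add: exp_minus field_simps)
    then have "complex_of_real (exp (- ln (2 * cosh b))) = of_real (1 / cosh b / 2)" by (simp only:)
    then show ?thesis by (simp flip: exp_of_real)
  qed
  have "integrable lborel (\<lambda>b::real. complex_of_real (1 / cosh b) / 2)"
    using integrable_cosh_powr[of "1/2"] unfolding e by simp
  from integrable_norm[OF integrable_mult_right[OF this, of 2]]
  show "integrable lborel (\<lambda>b::real. 1 / cosh b)"
    by (simp add: norm_divide)
  have "(LINT b|lborel. exp (\<i> * of_real (2 * \<tau> * b)) * of_real (1 / cosh b))
      = Gamma (1/2 + \<i> * of_real \<tau>) * Gamma (1 - (1/2 + \<i> * of_real \<tau>))"
    using Fourier_cosh_powr[of "1/2" "2 * \<tau>"] 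
    unfolding e unfolding times_divide_eq_right integral_divide_zero by (simp add: algebra_simps)
  also have "\<dots> = of_real pi / sin (of_real pi * (1/2 + \<i> * of_real \<tau>))"
    by (rule Gamma_reflection_complex)
  also have "sin (of_real pi * (1/2 + \<i> * of_real \<tau>)) = of_real (cosh (pi * \<tau>))"
    by (simp add: complex_eq_iff Re_sin Im_sin cosh_field_def algebra_simps)
  finally show "(LINT b|lborel. exp (\<i> * of_real (2 * \<tau> * b)) * of_real (1 / cosh b)) = of_real (pi / cosh (pi * \<tau>))"
    by simp
qed

text \<open>With C = cosh b and p = sinh v the denominator factors, cosh^2 b + sinh^2 v = cosh (b +
  v) cosh (b - v). Partial fractions and evenness in v then produce a convolution with the
  hyperbolic secant.\<close>

lemma integral_half_Gaussian_cosh: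
  fixes y b :: real
  assumes y: "y > 0"
  shows "(LINT q|lborel. exp (q / 2 - exp q - 2 * sqrt y * cosh b * exp (q / 2)))
      = 1 / sqrt pi * (LINT v|lborel. exp (- (y * (sinh v)\<^sup>2)) / cosh (b - v))"
    and "integrable lborel (\<lambda>v. exp (- (y * (sinh v)\<^sup>2)) / cosh (b - v))"
proof -
  define e where "e = (\<lambda>v. exp (- (y * (sinh v)\<^sup>2)))"
  have sech: "integrable lborel (\<lambda>v. 1 / cosh (b - v))"
    using lborel_integrable_real_affine[OF Fourier_sech(1), of "-1" b] by simp
  then show i: "integrable lborel (\<lambda>v. exp (- (y * (sinh v)\<^sup>2)) / cosh (b - v))"
    by (rule Bochner_Integration.integrable_bound) (use y in \<open>auto intro!: AE_I2 divide_right_mono\<close>)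
  then have i1: "integrable lborel (\<lambda>v. e v / cosh (b - v))"
    by (simp add: e_def)
  have i2: "integrable lborel (\<lambda>v. e v / cosh (b + v))"
    using lborel_integrable_real_affine[OF i1, of "-1" 0] by (simp add: e_def)
  have i12: "(LINT v|lborel. e v / cosh (b + v)) = (LINT v|lborel. e v / cosh (b - v))"
    using lborel_integral_real_affine[of "-1" "\<lambda>v. e v / cosh (b - v)" 0] by (simp add: e_def)
  have alg: "cosh b * (cosh v * (e v / ((cosh b)\<^sup>2 + (sinh v)\<^sup>2))) = (e v / cosh (b + v) + e v / cosh (b - v)) / 2" for v
  proof -
    have 1: "cosh (b + v) * cosh (b - v) = (cosh b)\<^sup>2 + (sinh v)\<^sup>2"
      by (simp add: cosh_add cosh_diff power2_eq_square algebra_simps)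
         (simp add: cosh_square_eq algebra_simps flip: power2_eq_square mult.assoc)
    have 2: "cosh (b + v) + cosh (b - v) = 2 * (cosh b * cosh v)"
      by (simp add: cosh_add cosh_diff)
    have "(e v / cosh (b + v) + e v / cosh (b - v)) / 2 = e v * (cosh (b + v) + cosh (b - v)) / (2 * (cosh (b + v) * cosh (b - v)))"
      by (simp add: field_simps)
    also have "\<dots> = cosh b * (cosh v * (e v / ((cosh b)\<^sup>2 + (sinh v)\<^sup>2)))"
    proof -
      have "k * (2 * (p * q)) / (2 * Q) = p * (q * (k / Q))" for k p q Q :: real by simp
      then show ?thesis unfolding 1 2 by blast
    qed
    finally show ?thesis by (rule sym)
  qed
  have "(LINT q|lborel. exp (q / 2 - exp q - 2 * sqrt y * cosh b * exp (q / 2)))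
      = cosh b / sqrt pi * (LINT p|lborel. exp (- (y * p\<^sup>2)) / ((cosh b)\<^sup>2 + p\<^sup>2))"
    by (rule integral_half_Gaussian[OF y]) simp
  also have "(LINT p|lborel. exp (- (y * p\<^sup>2)) / ((cosh b)\<^sup>2 + p\<^sup>2)) = (LINT v|lborel. cosh v * (e v / ((cosh b)\<^sup>2 + (sinh v)\<^sup>2)))"
    unfolding e_def by (rule change_of_variables_sinh(2)[symmetric]) measurable
  also have "cosh b / sqrt pi * \<dots> = 1 / sqrt pi * (LINT v|lborel. (e v / cosh (b + v) + e v / cosh (b - v)) / 2)"
    unfolding alg[symmetric] integral_mult_right_zero by simp
  also have "(LINT v|lborel. (e v / cosh (b + v) + e v / cosh (b - v)) / 2) = (LINT v|lborel. e v / cosh (b - v))"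
    using i1 i2 i12 by simp
  finally show "(LINT q|lborel. exp (q / 2 - exp q - 2 * sqrt y * cosh b * exp (q / 2)))
      = 1 / sqrt pi * (LINT v|lborel. exp (- (y * (sinh v)\<^sup>2)) / cosh (b - v))"
    by (simp add: e_def)
qed

text \<open>Expanding \<open>bessel_F\<close> and integrating q first leaves the Fourier transform,
  at 2 \<tau>, of the convolution of exp (- y sinh^2 v) with 1 / cosh. It factors: the secant gives
  pi / cosh (pi \<tau>), and sinh^2 v = (cosh (2 v) - 1) / 2 makes the Gaussian-like factor a Bessel
  integral at y / 2, with exp (y / 2) split off and the order halved to \<tau>.\<close>

lemma integral_exp_bessel_F:
  fixes y \<tau> :: real
  assumes y: "y > 0"
  shows "(LINT q|lborel. of_real (exp (q / 2 - exp q)) * bessel_F (2 * \<tau>) (2 * sqrt y * exp (q / 2)))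
    = of_real (sqrt pi / 2 * exp (y / 2) / cosh (pi * \<tau>)) * bessel_F \<tau> (y / 2)"
proof -
  define N where "N = (\<lambda>b q. exp (q / 2 - exp q - 2 * sqrt y * cosh b * exp (q / 2)))"
  define e where "e = (\<lambda>v. exp (- (y * (sinh v)\<^sup>2)))"
  define G where "G = (\<lambda>v b. exp (\<i> * of_real (2 * \<tau> * b)) * complex_of_real (e v / cosh (b - v)))"
  have N: "(LINT q|lborel. N b q) = 1 / sqrt pi * (LINT v|lborel. e v / cosh (b - v))" for b
    unfolding N_def e_def by (rule integral_half_Gaussian_cosh[OF y])
  have ie: "integrable lborel e"
  proof -
    have "integrable lborel (\<lambda>v. cosh v * exp (- (y * (sinh v)\<^sup>2)))"
      using change_of_variables_sinh(1)[of "\<lambda>p. exp (- (y * p\<^sup>2))"] integrable_Gaussian[OF y] by simp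
    then show ?thesis
      unfolding e_def by (rule Bochner_Integration.integrable_bound) (auto intro!: AE_I2 simp: cosh_real_ge_1 abs_mult)
  qed
  have sech: "integrable lborel (\<lambda>b. 1 / cosh (b - v))" "(LINT b|lborel. 1 / cosh (b - v)) = (LINT b|lborel. 1 / cosh b)" for v :: real
    using lborel_integrable_real_affine[OF Fourier_sech(1), of 1 "- v"]
      lborel_integral_real_affine[of 1 "\<lambda>b. 1 / cosh b" "- v"] by simp_all
  have iG: "integrable (lborel \<Otimes>\<^sub>M lborel) (case_prod G)"
  proof (rule lborel_pair.Fubini_integrable)
    show "case_prod G \<in> borel_measurable (lborel \<Otimes>\<^sub>M lborel)"
      unfolding G_def e_def by measurable
    have nG: "norm (G v b) = e v * (1 / cosh (b - v))" for v b
      by (simp add: G_def norm_mult e_def norm_divide)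
    show "integrable lborel (\<lambda>v. LINT b|lborel. norm (case (v, b) of (v, b) \<Rightarrow> G v b))"
      unfolding prod.case nG integral_mult_right_zero sech(2) using ie by simp
    show "AE v in lborel. integrable lborel (\<lambda>b. case (v, b) of (v, b) \<Rightarrow> G v b)"
    proof (rule AE_I2)
      fix v
      have "integrable lborel (\<lambda>b. e v * (1 / cosh (b - v)))"
        by (rule integrable_mult_right[OF sech(1)])
      then show "integrable lborel (\<lambda>b. case (v, b) of (v, b) \<Rightarrow> G v b)"
      proof (rule Bochner_Integration.integrable_bound)
        show "AE b in lborel. norm (case (v, b) of (v, b) \<Rightarrow> G v b) \<le> norm (e v * (1 / cosh (b - v)))"
          unfolding prod.case nG by (simp add: e_def)
      qed (simp add: G_def)
    qed
  qed
  define P where "P = (\<lambda>b q. exp (\<i> * of_real (2 * \<tau> * b)) * complex_of_real (N b q))"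
  have iN: "integrable lborel (N b)" for b
    unfolding N_def by (rule integrable_half_Gaussian[OF y]) simp
  have iP: "integrable (lborel \<Otimes>\<^sub>M lborel) (case_prod P)"
  proof (rule lborel_pair.Fubini_integrable)
    show "case_prod P \<in> borel_measurable (lborel \<Otimes>\<^sub>M lborel)"
      unfolding P_def N_def by measurable
    have nP: "norm (P b q) = N b q" for b q
      by (simp add: P_def norm_mult N_def)
    have "integrable lborel (\<lambda>b. LINT v|lborel. norm (G v b))"
      using lborel_pair.integrable_snd[of "\<lambda>v b. norm (G v b)"] integrable_norm[OF iG] by (simp add: case_prod_unfold)
    then have "integrable lborel (\<lambda>b. 1 / sqrt pi * (LINT v|lborel. e v / cosh (b - v)))"
      by (intro integrable_mult_right) (simp add: G_def norm_mult e_def norm_divide)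
    then show "integrable lborel (\<lambda>b. LINT q|lborel. norm (case (b, q) of (b, q) \<Rightarrow> P b q))"
      unfolding prod.case nP N .
    show "AE b in lborel. integrable lborel (\<lambda>q. case (b, q) of (b, q) \<Rightarrow> P b q)"
    proof (rule AE_I2)
      fix b
      show "integrable lborel (\<lambda>q. case (b, q) of (b, q) \<Rightarrow> P b q)"
        unfolding prod.case P_def by (intro integrable_mult_right integrable_of_real iN)
    qed
  qed
  have GB: "(LINT b|lborel. G v b) = of_real (e v) * exp (\<i> * of_real (2 * \<tau> * v)) * of_real (pi / cosh (pi * \<tau>))" for v
  proof -
    have "G v (v + 1 * b) = (of_real (e v) * exp (\<i> * of_real (2 * \<tau> * v))) * (exp (\<i> * of_real (2 * \<tau> * b)) * of_real (1 / cosh b))" for b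
      by (simp add: G_def algebra_simps exp_add)
    then show ?thesis
      using lborel_integral_real_affine[of 1 "G v" v] Fourier_sech(2)[of \<tau>]
      by (simp only: integral_mult_right_zero) simp
  qed
  have "of_real (exp (q / 2 - exp q)) * bessel_F (2 * \<tau>) (2 * sqrt y * exp (q / 2)) = (LINT b|lborel. P b q)" for q
    unfolding bessel_F_def integral_mult_right_zero[symmetric] P_def N_def
    by (simp add: algebra_simps flip: exp_of_real exp_add)
  then have "(LINT q|lborel. of_real (exp (q / 2 - exp q)) * bessel_F (2 * \<tau>) (2 * sqrt y * exp (q / 2)))
      = (LINT q|lborel. LINT b|lborel. P b q)" by simp
  also have "\<dots> = (LINT b|lborel. LINT q|lborel. P b q)"
    by (rule lborel_pair.Fubini_integral[OF iP])
  also have "\<dots> = (LINT b|lborel. of_real (1 / sqrt pi) * (LINT v|lborel. G v b))"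
  proof (rule Bochner_Integration.integral_cong[OF refl])
    fix b
    show "(LINT q|lborel. P b q) = of_real (1 / sqrt pi) * (LINT v|lborel. G v b)"
      unfolding P_def G_def integral_mult_right_zero integral_complex_of_real N by simp
  qed
  also have "\<dots> = of_real (1 / sqrt pi) * (LINT v|lborel. LINT b|lborel. G v b)"
    unfolding integral_mult_right_zero lborel_pair.Fubini_integral[OF iG] ..
  also have "(LINT v|lborel. LINT b|lborel. G v b) = (LINT v|lborel. of_real (e v) * exp (\<i> * of_real (2 * \<tau> * v)) * of_real (pi / cosh (pi * \<tau>)))"
    unfolding GB ..
  also have "(LINT v|lborel. of_real (e v) * exp (\<i> * of_real (2 * \<tau> * v)) * of_real (pi / cosh (pi * \<tau>)))
     = of_real (exp (y / 2) / 2) * bessel_F \<tau> (y / 2) * of_real (pi / cosh (pi * \<tau>))"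
  proof -
    have "complex_of_real (e v) * exp (\<i> * of_real (2 * \<tau> * v)) =
       of_real (exp (y / 2)) * exp (\<i> * of_real (\<tau> * (0 + 2 * v)) - of_real (y / 2 * cosh (0 + 2 * v)))" for v
    proof -
      have "- (y * (sinh v)\<^sup>2) = y / 2 - y / 2 * cosh (2 * v)"
      proof -
        have "cosh (2 * v) = 1 + 2 * (sinh v)\<^sup>2" by (simp add: cosh_double cosh_square_eq)
        then show ?thesis by (simp add: algebra_simps)
      qed
      then have "complex_of_real (e v) = exp (of_real (y / 2 - y / 2 * cosh (2 * v)))"
        by (simp only: e_def exp_of_real)
      then show ?thesis
        by (simp only: exp_of_real[symmetric] exp_add[symmetric]) (simp add: algebra_simps)
    qed
    then show ?thesis
      unfolding bessel_F_def integral_mult_left_zero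
      by (subst lborel_integral_real_affine[of 2 _ 0]) (simp_all add: scaleR_conv_of_real)
  qed
  also have "of_real (1 / sqrt pi) * (of_real (exp (y / 2) / 2) * bessel_F \<tau> (y / 2) * of_real (pi / cosh (pi * \<tau>)))
     = of_real (1 / sqrt pi * (exp (y / 2) / 2) * (pi / cosh (pi * \<tau>))) * bessel_F \<tau> (y / 2)"
    by (simp only: of_real_mult mult_ac)
  also have "1 / sqrt pi * (exp (y / 2) / 2) * (pi / cosh (pi * \<tau>)) = sqrt pi / 2 * exp (y / 2) / cosh (pi * \<tau>)"
    by (simp add: real_div_sqrt field_simps)
  finally show ?thesis .
qed

section \<open>The inverse Mellin transform of the triple Gamma product\<close>

definition Gamma_triple :: "real \<Rightarrow> real \<Rightarrow> real \<Rightarrow> complex" where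
  "Gamma_triple \<gamma> \<tau> t = Gamma (1/2 - Complex \<gamma> t) *
     (Gamma (Complex \<gamma> t + \<i> * of_real \<tau>) * Gamma (Complex \<gamma> t - \<i> * of_real \<tau>))"

text \<open>The mean of the squares bounds the product of the last two Gamma factors, and its
  integral in t is independent of \<tau>. The form \<open>\<tau> + 1 * t\<close> is that of an
  affine substitution.\<close>

definition Gamma_majorant :: "real \<Rightarrow> real \<Rightarrow> real \<Rightarrow> real" where
  "Gamma_majorant \<gamma> \<tau> t = Gamma (1/2 - \<gamma>) *
     (((norm (Gamma (Complex \<gamma> (\<tau> + 1 * t))))\<^sup>2 + (norm (Gamma (Complex \<gamma> (- \<tau> + 1 * t))))\<^sup>2) / 2)"

lemma norm_Gamma_triple_le:
  assumes "0 < \<gamma>" "\<gamma> < 1/2"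
  shows "norm (Gamma_triple \<gamma> \<tau> t) \<le> Gamma_majorant \<gamma> \<tau> t"
proof -
  have "Complex \<gamma> t + \<i> * of_real \<tau> = Complex \<gamma> (\<tau> + 1 * t)" "Complex \<gamma> t - \<i> * of_real \<tau> = Complex \<gamma> (- \<tau> + 1 * t)"
    by (simp_all add: complex_eq_iff)
  moreover have "norm (Gamma (1/2 - Complex \<gamma> t)) \<le> Gamma (1/2 - \<gamma>)"
    using norm_Gamma_le[of "1/2 - Complex \<gamma> t"] assms by simp
  moreover have "a * b \<le> (a\<^sup>2 + b\<^sup>2) / 2" for a b :: real
    using sum_squares_bound[of a b] by simp
  ultimately show ?thesis
    unfolding Gamma_triple_def Gamma_majorant_def norm_mult using assms
    by (intro mult_mono) (auto simp del: mult_1 intro!: Gamma_real_nonneg)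
qed

lemma
  assumes "0 < \<gamma>"
  shows integrable_Gamma_majorant: "integrable lborel (Gamma_majorant \<gamma> \<tau>)"
    and integral_Gamma_majorant: "(LINT t|lborel. Gamma_majorant \<gamma> \<tau> t)
      = Gamma (1/2 - \<gamma>) * (LINT t|lborel. (norm (Gamma (Complex \<gamma> t)))\<^sup>2)"
proof -
  let ?A = "\<lambda>t. (norm (Gamma (Complex \<gamma> t)))\<^sup>2"
  have i: "integrable lborel (\<lambda>t. ?A (u + 1 * t))" "(LINT t|lborel. ?A (u + 1 * t)) = (LINT t|lborel. ?A t)" for u
    using lborel_integrable_real_affine[OF integrable_norm_Gamma_square[OF assms], of 1 u]
      lborel_integral_real_affine[of 1 ?A u] by simp_all
  show "integrable lborel (Gamma_majorant \<gamma> \<tau>)"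
    unfolding Gamma_majorant_def[abs_def] using i(1) by (intro integrable_mult_right integrable_divide Bochner_Integration.integrable_add)
  show "(LINT t|lborel. Gamma_majorant \<gamma> \<tau> t) = Gamma (1/2 - \<gamma>) * (LINT t|lborel. ?A t)"
    unfolding Gamma_majorant_def integral_mult_right_zero integral_divide_zero
    by (subst Bochner_Integration.integral_add[OF i(1) i(1)]) (simp only: i(2), simp)
qed

lemma borel_measurable_Gamma_triple [measurable]:
  "case_prod (Gamma_triple \<gamma>) \<in> borel_measurable (borel \<Otimes>\<^sub>M borel)"
  unfolding Gamma_triple_def by measurable

lemma integrable_Gamma_triple:
  assumes "0 < \<gamma>" "\<gamma> < 1/2"
  shows "integrable lborel (Gamma_triple \<gamma> \<tau>)"
proof (rule Bochner_Integration.integrable_bound[OF integrable_Gamma_majorant[OF assms(1), of \<tau>]])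
  show "AE t in lborel. norm (Gamma_triple \<gamma> \<tau> t) \<le> norm (Gamma_majorant \<gamma> \<tau> t)"
    using norm_Gamma_triple_le[OF assms] by (intro AE_I2) (auto intro: order_trans[OF _ abs_ge_self])
qed simp

text \<open>The triple product is the Fourier transform of \<open>D\<close>, the Mellin convolution
  in logarithmic variables with the weight exp (\<gamma> \<eta>) that places s on the line of real
  part \<gamma>.\<close>

lemma inverse_Mellin_Gamma_triple:
  assumes \<gamma>: "0 < \<gamma>" "\<gamma> < 1/2"
  shows "(LINT t|lborel. Gamma_triple \<gamma> \<tau> t * exp (- \<i> * of_real (t * \<eta>))) = 2 * of_real pi * (of_real (exp (\<gamma> * \<eta>)) *
     (LINT q|lborel. of_real (exp (q / 2 - exp q)) * bessel_F (2 * \<tau>) (2 * exp ((\<eta> + q) / 2))))"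
proof -
  define D where "D = (\<lambda>\<eta>. LINT q|lborel. of_real (exp (\<gamma> * \<eta>)) *
    (of_real (exp (q / 2 - exp q)) * bessel_F (2 * \<tau>) (2 * exp ((\<eta> + q) / 2))))"
  \<comment> \<open>From \<open>bessel_L_bound\<close> with exponent 2 \<gamma>: the power of the
    argument cancels exp (\<gamma> \<eta>), so the majorant is free of \<eta> and yields both
    boundedness and continuity of \<open>D\<close>. It is integrable at minus infinity because
    \<gamma> < 1/2.\<close>
  define w where "w = (\<lambda>q. Gamma (2 * \<gamma>) * 4 powr (- \<gamma>) * exp ((1/2 - \<gamma>) * q - 1 * exp q))"
  have iw: "integrable lborel w"
    unfolding w_def by (intro integrable_mult_right integrable_Gamma_exp_real) (use \<gamma> in auto)
  have nw: "norm (complex_of_real (exp (\<gamma> * \<eta>)) * (of_real (exp (q / 2 - exp q)) * bessel_F (2 * \<tau>) (2 * exp ((\<eta> + q) / 2)))) \<le> w q" for \<eta> q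
  proof -
    define x where "x = 2 * exp ((\<eta> + q) / 2)"
    have "x powr (2 * \<gamma>) * bessel_L x \<le> Gamma (2 * \<gamma>)"
      by (rule bessel_L_bound) (use \<gamma> in \<open>auto simp: x_def\<close>)
    moreover have "x powr (2 * \<gamma>) = 4 powr \<gamma> * exp (\<gamma> * (\<eta> + q))"
    proof -
      have "ln (4::real) = 2 * ln 2" using ln_realpow[of 2 2] by simp
      then show ?thesis by (simp add: x_def powr_def ln_mult algebra_simps flip: exp_add)
    qed
    ultimately have "exp (\<gamma> * (\<eta> + q)) * bessel_L x \<le> Gamma (2 * \<gamma>) * 4 powr (- \<gamma>)"
      by (simp add: powr_minus field_simps)
    then have L: "exp (\<gamma> * (\<eta> + q)) * norm (bessel_F (2 * \<tau>) x) \<le> Gamma (2 * \<gamma>) * 4 powr (- \<gamma>)"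
      by (rule order_trans[rotated]) (simp add: norm_bessel_F_le)
    have "norm (complex_of_real (exp (\<gamma> * \<eta>)) * (of_real (exp (q / 2 - exp q)) * bessel_F (2 * \<tau>) x)) =
        (exp (\<gamma> * \<eta>) * exp (q / 2 - exp q)) * norm (bessel_F (2 * \<tau>) x)"
      by (simp add: norm_mult)
    also have "exp (\<gamma> * \<eta>) * exp (q / 2 - exp q) = exp (\<gamma> * (\<eta> + q)) * exp ((1/2 - \<gamma>) * q - 1 * exp q)"
      unfolding exp_add[symmetric] by (simp add: algebra_simps)
    also have "\<dots> * norm (bessel_F (2 * \<tau>) x) = (exp (\<gamma> * (\<eta> + q)) * norm (bessel_F (2 * \<tau>) x)) * exp ((1/2 - \<gamma>) * q - 1 * exp q)"
      by (simp only: mult_ac)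
    also have "\<dots> \<le> w q"
      unfolding w_def by (rule mult_right_mono[OF L]) simp
    finally show ?thesis by (simp add: x_def)
  qed
  define P where "P = (\<lambda>t q \<eta>. exp (\<i> * of_real (t * \<eta>)) * (of_real (exp (\<gamma> * \<eta>)) *
    (of_real (exp (q / 2 - exp q)) * bessel_F (2 * \<tau>) (2 * exp ((\<eta> + q) / 2)))))"
  \<comment> \<open>The substitution \<eta> = 2 m - q separates the integrand into a function of q
    and a function of m.\<close>
  have P_shift: "P t q (- q + 2 * m) = exp ((1/2 - Complex \<gamma> t) * of_real q - of_real (1 * exp q)) *
      (exp (2 * Complex \<gamma> t * of_real m) * bessel_F (2 * \<tau>) (2 * exp m))" for t q m
  proof -
    have "P t q (- q + 2 * m) = exp (\<i> * of_real (t * (- q + 2 * m)) + of_real (\<gamma> * (- q + 2 * m)) + of_real (q / 2 - exp q)) *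
       bessel_F (2 * \<tau>) (2 * exp m)"
      by (simp add: P_def exp_add flip: exp_of_real)
    also have "\<i> * of_real (t * (- q + 2 * m)) + of_real (\<gamma> * (- q + 2 * m)) + of_real (q / 2 - exp q) =
       ((1/2 - Complex \<gamma> t) * of_real q - of_real (1 * exp q)) + 2 * Complex \<gamma> t * of_real m"
      by (simp add: complex_eq_iff algebra_simps)
    finally show ?thesis by (simp only: exp_add mult.assoc)
  qed
  have M: "integrable lborel (\<lambda>m. exp (2 * Complex \<gamma> t * of_real m) * bessel_F (2 * \<tau>) (2 * exp m))" for t
    by (rule integrable_Mellin_bessel_F) (use \<gamma> in simp)
  have E: "integrable lborel (\<lambda>q. exp ((1/2 - Complex \<gamma> t) * of_real q - of_real (1 * exp q)))" for t
    by (rule integrable_Gamma_exp) (use \<gamma> in auto)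
  have iP: "integrable (lborel \<Otimes>\<^sub>M lborel) (case_prod (P t))" for t
  proof (rule lborel_pair.Fubini_integrable)
    show "case_prod (P t) \<in> borel_measurable (lborel \<Otimes>\<^sub>M lborel)"
      unfolding P_def by measurable
    have "(LINT \<eta>|lborel. norm (P t q \<eta>)) = norm (exp ((1/2 - Complex \<gamma> t) * of_real q - of_real (1 * exp q))) *
       (2 * (LINT m|lborel. norm (exp (2 * Complex \<gamma> t * of_real m) * bessel_F (2 * \<tau>) (2 * exp m))))" for q
      by (subst lborel_integral_real_affine[of 2 _ "- q"]) (simp_all only: P_shift norm_mult integral_mult_right_zero, simp_all)
    then show "integrable lborel (\<lambda>q. LINT \<eta>|lborel. norm (case (q, \<eta>) of (q, \<eta>) \<Rightarrow> P t q \<eta>))"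
      unfolding prod.case by (simp only:) (intro integrable_mult_left integrable_norm E)
    have "integrable lborel (\<lambda>m. P t q (- q + 2 * m))" for q
      unfolding P_shift by (rule integrable_mult_right[OF M])
    then show "AE q in lborel. integrable lborel (\<lambda>\<eta>. case (q, \<eta>) of (q, \<eta>) \<Rightarrow> P t q \<eta>)"
      by (subst (asm) lborel_integrable_real_affine_iff) auto
  qed
  have DP: "exp (\<i> * of_real (t * \<eta>)) * D \<eta> = (LINT q|lborel. P t q \<eta>)" for t \<eta>
    unfolding P_def D_def integral_mult_right_zero ..
  have iD: "integrable lborel D"
  proof -
    have "integrable lborel (\<lambda>\<eta>. exp (\<i> * of_real (0 * \<eta>)) * D \<eta>)"
      unfolding DP using lborel_pair.integrable_snd[OF iP[of 0]] .
    then show ?thesis by simp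
  qed
  have "(LINT t|lborel. Gamma_triple \<gamma> \<tau> t * exp (- \<i> * of_real (t * \<eta>))) = 2 * of_real pi * D \<eta>"
  proof (rule Fourier_inversion_at)
    show "integrable lborel D" by (rule iD)
    show "norm (D x) \<le> (LINT q|lborel. w q)" for x
    proof -
      have i: "integrable lborel (\<lambda>q. complex_of_real (exp (\<gamma> * x)) * (of_real (exp (q / 2 - exp q)) * bessel_F (2 * \<tau>) (2 * exp ((x + q) / 2))))"
      proof (rule Bochner_Integration.integrable_bound[OF iw])
        show "AE q in lborel. norm (complex_of_real (exp (\<gamma> * x)) * (of_real (exp (q / 2 - exp q)) * bessel_F (2 * \<tau>) (2 * exp ((x + q) / 2)))) \<le> norm (w q)"
          by (rule AE_I2, rule order_trans[OF nw]) simp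
      qed simp
      show ?thesis
        unfolding D_def by (rule Bochner_Integration.integral_norm_bound_integral[OF i iw nw])
    qed
    show "isCont D \<eta>"
      unfolding D_def
    proof (rule isCont_integral_dominated)
      show "open UNIV" "\<eta> \<in> UNIV" by auto
      show "integrable lborel w" by (rule iw)
      fix q
      have "isCont (\<lambda>x. 2 * exp ((x + q) / 2)) \<eta>" by (intro continuous_intros) auto
      from isCont_o2[OF this isCont_bessel_F[of _ "2 * \<tau>"]]
      have "isCont (\<lambda>x. bessel_F (2 * \<tau>) (2 * exp ((x + q) / 2))) \<eta>" by simp
      then show "isCont (\<lambda>x. complex_of_real (exp (\<gamma> * x)) * (of_real (exp (q / 2 - exp q)) * bessel_F (2 * \<tau>) (2 * exp ((x + q) / 2)))) \<eta>"
        by (intro continuous_intros)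
    qed (simp, rule nw)
    show "Gamma_triple \<gamma> \<tau> t = (LINT x|lborel. exp (\<i> * of_real (t * x)) * D x)" for t
    proof -
      have inner: "(LINT x|lborel. P t q x) = exp ((1/2 - Complex \<gamma> t) * of_real q - of_real (1 * exp q)) *
          (2 * (LINT m|lborel. exp (2 * Complex \<gamma> t * of_real m) * bessel_F (2 * \<tau>) (2 * exp m)))" for q
        by (subst lborel_integral_real_affine[of 2 _ "- q"]) (simp_all only: P_shift integral_mult_right_zero, simp_all add: scaleR_conv_of_real)
      have "(LINT x|lborel. exp (\<i> * of_real (t * x)) * D x) = (LINT q|lborel. LINT x|lborel. P t q x)"
        unfolding DP by (rule lborel_pair.Fubini_integral[OF iP])
      also have "\<dots> = Gamma_triple \<gamma> \<tau> t"
        unfolding inner integral_mult_left_zero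
        using integral_Gamma_exp[of "1/2 - Complex \<gamma> t" 1] Mellin_bessel_F[of "Complex \<gamma> t" "2 * \<tau>"] \<gamma>
        by (simp add: Gamma_triple_def)
      finally show ?thesis ..
    qed
    show "integrable lborel (Gamma_triple \<gamma> \<tau>)"
      by (rule integrable_Gamma_triple[OF \<gamma>])
  qed
  then show ?thesis
    by (simp only: D_def integral_mult_right_zero)
qed

lemma inverse_Mellin_Gamma_triple_bessel:
  assumes \<gamma>: "0 < \<gamma>" "\<gamma> < 1/2" and y: "y > 0"
  shows "(LINT t|lborel. Gamma_triple \<gamma> \<tau> t * exp (- \<i> * of_real (t * ln y))) =
     of_real (pi * sqrt pi * y powr \<gamma> * exp (y / 2) / cosh (pi * \<tau>)) * bessel_F \<tau> (y / 2)"
proof -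
  have "exp ((ln y + q) / 2) = sqrt y * exp (q / 2)" for q
    using y by (simp add: add_divide_distrib exp_add powr_half_sqrt[symmetric] powr_def)
  then have "2 * exp ((ln y + q) / 2) = 2 * sqrt y * exp (q / 2)" for q
    by simp
  then show ?thesis
    unfolding inverse_Mellin_Gamma_triple[OF \<gamma>]
    using integral_exp_bessel_F[OF y, of \<tau>] y by (simp add: powr_def mult_ac)
qed

section \<open>The transform\<close>

lemma kelvin_kernel_exp_measurable [measurable]:
  "(\<lambda>(\<tau>, p). kelvin_kernel (exp p) \<tau>) \<in> borel_measurable (borel \<Otimes>\<^sub>M borel)"
  unfolding kelvin_kernel_eq[OF exp_gt_zero] by measurable

lemma kelvin_kernel_measurable:
  assumes "x > 0"
  shows "kelvin_kernel x \<in> borel_measurable borel"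
  unfolding kelvin_kernel_eq[OF assms, abs_def] by measurable

text \<open>The joint measurability needed for Fubini is available over \<open>lborel\<close>; a
  Borel representative connects it with functions that are only Lebesgue measurable.\<close>

lemma integrable_lebesgue_ex_borel:
  fixes f :: "real \<Rightarrow> complex"
  assumes f: "integrable lebesgue f"
  obtains f' where "f' \<in> borel_measurable borel" "integrable lborel f'" "AE x in lborel. f x = f' x"
proof -
  have "(\<lambda>x. Re (f x)) \<in> borel_measurable lebesgue" "(\<lambda>x. Im (f x)) \<in> borel_measurable lebesgue"
    using borel_measurable_integrable[OF f] by auto
  then obtain a b where ab: "a \<in> borel_measurable borel" "AE x in lborel. Re (f x) = a x"
     "b \<in> borel_measurable borel" "AE x in lborel. Im (f x) = b x"
    using completion_ex_borel_measurable_real[of "\<lambda>x. Re (f x)" lborel]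
      completion_ex_borel_measurable_real[of "\<lambda>x. Im (f x)" lborel] by auto
  define f' where "f' = (\<lambda>x. Complex (a x) (b x))"
  have m: "f' \<in> borel_measurable borel"
    unfolding f'_def Complex_eq using ab by measurable
  have ae: "AE x in lborel. f x = f' x"
    using ab(2,4) by eventually_elim (simp add: f'_def complex_eq_iff)
  have "integrable lebesgue f'"
    by (rule integrable_cong_AE_imp[OF f]) (use m AE_completion[OF ae] in \<open>auto intro: measurable_completion\<close>)
  then have "integrable lborel f'"
    using m by (simp add: integrable_completion)
  with m ae that show ?thesis by blast
qed

lemma mellin_eq_integral_exp:
  assumes [measurable]: "(\<lambda>x. indicator {0<..} x *\<^sub>R f x) \<in> borel_measurable borel"
  shows "mellin f s = (LINT p|lborel. exp (s * of_real p) * f (exp p))"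
proof -
  define h where "h = (\<lambda>x. f x * of_real x powr (s - 1))"
  have m: "(\<lambda>x. indicator {0<..} x *\<^sub>R h x) \<in> borel_measurable borel"
  proof -
    have "(\<lambda>x. (indicator {0<..} x *\<^sub>R f x) * exp ((s - 1) * of_real (ln x))) \<in> borel_measurable borel"
      by measurable
    also have "(\<lambda>x. (indicator {0<..} x *\<^sub>R f x) * exp ((s - 1) * of_real (ln x))) = (\<lambda>x. indicator {0<..} x *\<^sub>R h x)"
      by (auto simp: fun_eq_iff h_def powr_def Ln_of_real indicator_def)
    finally show ?thesis .
  qed
  have e: "exp p *\<^sub>R h (exp p) = exp (s * of_real p) * f (exp p)" for p
  proof -
    have "exp p *\<^sub>R h (exp p) = (exp (of_real p) * exp ((s - 1) * of_real p)) * f (exp p)"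
      by (simp add: h_def powr_def Ln_of_real scaleR_conv_of_real flip: exp_of_real)
    also have "exp (of_real p) * exp ((s - 1) * of_real p) = exp (s * of_real p)"
      unfolding exp_add[symmetric] by (simp add: algebra_simps)
    finally show ?thesis .
  qed
  have "mellin f s = (LINT x:{0<..}|lborel. h x)"
    unfolding mellin_def set_lebesgue_integral_def h_def[symmetric]
    using m by (simp add: integral_completion)
  also have "\<dots> = (LINT p|lborel. exp p *\<^sub>R h (exp p))"
    by (rule change_of_variables_exp(2)[OF m, symmetric])
  finally show ?thesis unfolding e .
qed

text \<open>Serves both multipliers of \<open>g\<close> in the theorem: the kernel at fixed x, and
  the Bessel factor divided by cosh (pi \<tau>). The indicator is absorbed into \<open>g'\<close>,
  so the integrals over \<open>lborel\<close> extend over the whole line.\<close>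

lemma set_integral_lebesgue_mult_bounded:
  fixes g g' \<phi> :: "real \<Rightarrow> complex"
  assumes g: "set_integrable lebesgue {0<..} g"
    and g': "g' \<in> borel_measurable borel" "integrable lborel g'" "AE x in lborel. indicator {0<..} x *\<^sub>R g x = g' x"
    and \<phi>: "\<phi> \<in> borel_measurable borel" "\<And>x. norm (\<phi> x) \<le> B"
  shows "set_integrable lebesgue {0<..} (\<lambda>x. \<phi> x * g x)"
    and "(LINT x:{0<..}|lebesgue. \<phi> x * g x) = (LINT x|lborel. \<phi> x * g' x)"
    and "integrable lborel (\<lambda>x. \<phi> x * g' x)"
proof -
  show i: "integrable lborel (\<lambda>x. \<phi> x * g' x)"
  proof (rule Bochner_Integration.integrable_bound)
    show "integrable lborel (\<lambda>x. B * norm (g' x))"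
      using g'(2) by simp
    show "AE x in lborel. norm (\<phi> x * g' x) \<le> norm (B * norm (g' x))"
      using \<phi>(2) by (intro AE_I2) (auto simp: norm_mult intro!: order_trans[OF _ abs_ge_self] mult_right_mono)
  qed (use g' \<phi> in measurable)
  have m: "(\<lambda>x. indicator {0<..} x *\<^sub>R (\<phi> x * g x)) \<in> borel_measurable lebesgue"
  proof -
    have "(\<lambda>x. \<phi> x * (indicator {0<..} x *\<^sub>R g x)) \<in> borel_measurable lebesgue"
      using borel_measurable_integrable[OF g[unfolded set_integrable_def]] \<phi>(1)
      by (intro borel_measurable_times) (auto intro: measurable_completion)
    then show ?thesis by simp
  qed
  have m': "(\<lambda>x. \<phi> x * g' x) \<in> borel_measurable lborel"
    using g' \<phi> by measurable
  have ae: "AE x in lebesgue. \<phi> x * g' x = indicator {0<..} x *\<^sub>R (\<phi> x * g x)"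
  proof (rule AE_completion)
    show "AE x in lborel. \<phi> x * g' x = indicator {0<..} x *\<^sub>R (\<phi> x * g x)"
      using g'(3) by eventually_elim (metis mult_scaleR_right)
  qed
  have i': "integrable lebesgue (\<lambda>x. \<phi> x * g' x)"
    using i m' by (simp add: integrable_completion)
  show "set_integrable lebesgue {0<..} (\<lambda>x. \<phi> x * g x)"
    unfolding set_integrable_def by (rule integrable_cong_AE_imp[OF i' m]) (use ae in auto)
  have "(LINT x:{0<..}|lebesgue. \<phi> x * g x) = (LINT x|lebesgue. \<phi> x * g' x)"
    unfolding set_lebesgue_integral_def
    by (rule integral_cong_AE) (use m ae i' in \<open>auto elim!: eventually_mono\<close>)
  also have "\<dots> = (LINT x|lborel. \<phi> x * g' x)"
    using m' by (rule integral_completion)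
  finally show "(LINT x:{0<..}|lebesgue. \<phi> x * g x) = (LINT x|lborel. \<phi> x * g' x)" .
qed

lemma Mellin_kelvin_transform_borel:
  fixes g :: "real \<Rightarrow> complex" and s :: complex
  assumes g: "g \<in> borel_measurable borel" "integrable lborel g" and s: "Re s > 0"
  shows "(LINT p|lborel. exp (s * of_real p) * (LINT \<tau>|lborel. kelvin_kernel (exp p) \<tau> * g \<tau>))
    = exp (- s * of_real (ln 4)) / 4 * Gamma (2 * s) *
      (LINT \<tau>|lborel. Gamma (s + \<i> * of_real \<tau>) * Gamma (s - \<i> * of_real \<tau>) * g \<tau>)"
proof -
  note [measurable] = g(1)
  \<comment> \<open>The integrand at order 0. For every \<tau> the kernel differs under the integral
    only by a phase, so \<open>k0\<close> dominates simultaneously and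
    \<open>k0 p * norm (g \<tau>)\<close> justifies Fubini.\<close>
  define E where "E = (\<lambda>y p. exp (s * of_real p) *
      (exp (\<i> * of_real (2 * 0 * y)) * complex_of_real (bessel_L (4 * exp p powr (1/4) * sqrt (cosh y)))))"
  define k0 where "k0 = (\<lambda>p. LINT y|lborel. norm (E y p))"
  have "integrable (lborel \<Otimes>\<^sub>M lborel) (case_prod E)"
    unfolding E_def by (rule integrable_Mellin_kernel_integrand[OF s])
  then have k0: "integrable lborel k0"
    unfolding k0_def using lborel_pair.integrable_snd[of "\<lambda>y p. norm (E y p)"] integrable_norm
    by (fastforce simp: case_prod_unfold)
  have k0_nonneg: "k0 p \<ge> 0" for p unfolding k0_def by simp
  have nk: "norm (exp (s * of_real p) * kelvin_kernel (exp p) \<tau>) \<le> k0 p" for p \<tau>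
  proof -
    have "norm (exp (s * of_real p) * kelvin_kernel (exp p) \<tau>) =
      norm (LINT y|lborel. exp (s * of_real p) * (exp (\<i> * of_real (2 * \<tau> * y)) * complex_of_real (bessel_L (4 * exp p powr (1/4) * sqrt (cosh y))))) / 4"
      by (simp add: kelvin_kernel_eq norm_mult norm_divide)
    also have "\<dots> \<le> k0 p / 4"
      unfolding k0_def E_def
      by (intro divide_right_mono order_trans[OF integral_norm_bound]) (simp_all add: norm_mult)
    finally show ?thesis using k0_nonneg[of p] by simp
  qed
  define H where "H = (\<lambda>\<tau> p. exp (s * of_real p) * kelvin_kernel (exp p) \<tau> * g \<tau>)"
  have [measurable]: "case_prod H \<in> borel_measurable (borel \<Otimes>\<^sub>M borel)"
    unfolding H_def by measurable
  have nH: "norm (H \<tau> p) \<le> k0 p * norm (g \<tau>)" for \<tau> p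
    unfolding H_def norm_mult[of _ "g \<tau>"] by (rule mult_right_mono[OF nk]) simp
  have H1: "integrable lborel (H \<tau>)" for \<tau>
  proof (rule Bochner_Integration.integrable_bound)
    show "integrable lborel (\<lambda>p. k0 p * norm (g \<tau>))" using k0 by simp
    show "AE p in lborel. norm (H \<tau> p) \<le> norm (k0 p * norm (g \<tau>))"
      by (rule AE_I2, rule order_trans[OF nH]) simp
  qed simp
  have iH: "integrable (lborel \<Otimes>\<^sub>M lborel) (case_prod H)"
  proof (rule lborel_pair.Fubini_integrable)
    show "AE \<tau> in lborel. integrable lborel (\<lambda>p. case (\<tau>, p) of (\<tau>, p) \<Rightarrow> H \<tau> p)"
      using H1 by simp
    show "integrable lborel (\<lambda>\<tau>. LINT p|lborel. norm (case (\<tau>, p) of (\<tau>, p) \<Rightarrow> H \<tau> p))"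
    proof (rule Bochner_Integration.integrable_bound)
      show "integrable lborel (\<lambda>\<tau>. (LINT p|lborel. k0 p) * norm (g \<tau>))" using g(2) by simp
      show "AE \<tau> in lborel. norm (LINT p|lborel. norm (case (\<tau>, p) of (\<tau>, p) \<Rightarrow> H \<tau> p)) \<le> norm ((LINT p|lborel. k0 p) * norm (g \<tau>))"
      proof (rule AE_I2)
        fix \<tau>
        have "(LINT p|lborel. norm (H \<tau> p)) \<le> (LINT p|lborel. k0 p * norm (g \<tau>))"
          by (rule integral_mono[OF integrable_norm[OF H1] _ nH]) (use k0 in simp)
        then show "norm (LINT p|lborel. norm (case (\<tau>, p) of (\<tau>, p) \<Rightarrow> H \<tau> p)) \<le> norm ((LINT p|lborel. k0 p) * norm (g \<tau>))"
          by (simp add: order_trans[OF _ abs_ge_self])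
      qed
    qed simp
  qed simp
  have "(LINT p|lborel. exp (s * of_real p) * (LINT \<tau>|lborel. kelvin_kernel (exp p) \<tau> * g \<tau>)) = (LINT p|lborel. LINT \<tau>|lborel. H \<tau> p)"
    unfolding H_def mult.assoc integral_mult_right_zero ..
  also have "\<dots> = (LINT \<tau>|lborel. LINT p|lborel. H \<tau> p)"
    by (rule lborel_pair.Fubini_integral[OF iH])
  also have "\<dots> = (LINT \<tau>|lborel. (exp (- s * of_real (ln 4)) / 4 * Gamma (2 * s)) *
      (Gamma (s + \<i> * of_real \<tau>) * Gamma (s - \<i> * of_real \<tau>) * g \<tau>))"
    unfolding H_def integral_mult_left_zero Mellin_kelvin_kernel[OF s] by (simp only: mult.assoc)
  finally show ?thesis by (simp only: integral_mult_right_zero)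
qed

text \<open>Legendre's formula gives Gamma s Gamma (s + 1/2) = 2^(1 - 2 s) sqrt pi Gamma (2 s), so
  both Gamma (2 s) and 4^(-s) cancel; the constant is 4 * 2 * sqrt pi.\<close>

lemma Gamma_quotient_duplication:
  fixes s :: complex
  assumes "Re s > 0"
  shows "Gamma (1/2 - s) / (Gamma s * Gamma (1/2 + s)) * (exp (- s * of_real (ln 4)) / 4 * Gamma (2 * s))
    = Gamma (1/2 - s) / of_real (8 * sqrt pi)"
proof -
  have nz: "Gamma (2 * s) \<noteq> 0"
    using assms by (simp add: Gamma_eq_zero_iff Re_pos_not_nonpos_Ints)
  have "Gamma s * Gamma (1/2 + s) = exp ((1 - 2 * s) * of_real (ln 2)) * of_real (sqrt pi) * Gamma (2 * s)"
    using Gamma_legendre_duplication[of s] assms by (simp add: Re_pos_not_nonpos_Ints add.commute)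
  moreover have "exp ((1 - 2 * s) * of_real (ln 2)) = 2 * exp (- s * of_real (ln 4))"
  proof -
    have "(1 - 2 * s) * of_real (ln 2) = of_real (ln 2) + - s * of_real (ln 4)"
      using ln_realpow[of 2 2] by (simp add: algebra_simps)
    then have "exp ((1 - 2 * s) * of_real (ln 2)) = of_real (exp (ln 2)) * exp (- s * of_real (ln 4))"
      by (simp only: exp_add exp_of_real)
    then show ?thesis by simp
  qed
  ultimately show ?thesis using nz by simp
qed

theorem theorem4:
  fixes \<gamma> :: real and g :: "real \<Rightarrow> complex"
  assumes "\<gamma> > 0" and "set_integrable lebesgue {0<..} g"
  shows
    "(\<forall>x>0. set_integrable lebesgue {0<..} (\<lambda>\<tau>. kelvin_kernel x \<tau> * g \<tau>)) \<and>
     bounded ((\<lambda>x. of_real (x powr \<gamma>) * kelvin_transform g x) ` {0<..}) \<and>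
     continuous_on {0<..} (\<lambda>x. of_real (x powr \<gamma>) * kelvin_transform g x) \<and>
     (SUP x\<in>{0<..}. norm (of_real (x powr \<gamma>) * kelvin_transform g x))
       \<le> kelvin_bound \<gamma> * (LINT \<tau>:{0<..}|lebesgue. norm (g \<tau>)) \<and>
     (\<gamma> < 1/2 \<longrightarrow>
      kelvin_transform g \<in> weighted_L1 \<gamma> \<longrightarrow>
      vline_integrable \<gamma> (\<lambda>s. of_real (norm s powr (1/2 - 2 * \<gamma>) * exp (pi * norm s / 2))
                              * mellin (kelvin_transform g) s) \<longrightarrow>
      (\<forall>y>0.
         vline_integrable \<gamma> (\<lambda>s. Gamma (1/2 - s) / (Gamma s * Gamma (1/2 + s))
                                 * mellin (kelvin_transform g) s * of_real y powr (- s)) \<and>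
         set_integrable lebesgue {0<..}
           (\<lambda>\<tau>. bessel_K (\<i> * of_real \<tau>) (of_real (y / 2)) * (g \<tau> / of_real (cosh (pi * \<tau>)))) \<and>
         1 / (2 * of_real pi * \<i>) *
           vline_integral \<gamma> (\<lambda>s. Gamma (1/2 - s) / (Gamma s * Gamma (1/2 + s))
                                 * mellin (kelvin_transform g) s * of_real y powr (- s))
         = of_real (exp (y / 2) / 8) *
           (LINT \<tau>:{0<..}|lebesgue.
              bessel_K (\<i> * of_real \<tau>) (of_real (y / 2)) * (g \<tau> / of_real (cosh (pi * \<tau>))))))"
proof -
  have \<gamma>: "\<gamma> > 0" and g: "set_integrable lebesgue {0<..} g" using assms by auto
  obtain g' where g': "g' \<in> borel_measurable borel" "integrable lborel g'"
    "AE x in lborel. indicator {0<..} x *\<^sub>R g x = g' x"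
    using integrable_lebesgue_ex_borel[OF g[unfolded set_integrable_def]] by blast
  note [measurable] = g'(1)
  note transfer = set_integral_lebesgue_mult_bounded[OF g g']
  define C where "C = kelvin_bound \<gamma>"
  have nk: "norm (kelvin_kernel x \<tau>) \<le> C * x powr (- \<gamma>)" if "x > 0" for x \<tau>
    using norm_kelvin_kernel_le[OF \<gamma> that] unfolding C_def kelvin_bound_eq[OF \<gamma>] .
  have C0: "C \<ge> 0"
    using order_trans[OF norm_ge_zero nk[of 1]] by simp
  note tr = transfer[OF kelvin_kernel_measurable nk]
  have G: "kelvin_transform g x = (LINT \<tau>|lborel. kelvin_kernel x \<tau> * g' \<tau>)" if "x > 0" for x
    unfolding kelvin_transform_def by (rule tr(2)[OF that that])
  have norm_g: "(LINT \<tau>:{0<..}|lebesgue. norm (g \<tau>)) = (LINT \<tau>|lborel. norm (g' \<tau>))"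
  proof -
    have "(LINT \<tau>:{0<..}|lebesgue. norm (g \<tau>)) = (LINT \<tau>|lebesgue. norm (indicator {0<..} \<tau> *\<^sub>R g \<tau>))"
      unfolding set_lebesgue_integral_def by simp
    also have "\<dots> = (LINT \<tau>|lebesgue. norm (g' \<tau>))"
    proof (rule integral_cong_AE)
      show "(\<lambda>\<tau>. norm (indicator {0<..} \<tau> *\<^sub>R g \<tau>)) \<in> borel_measurable lebesgue"
        by (rule borel_measurable_integrable, rule integrable_norm) (use g in \<open>simp only: set_integrable_def\<close>)
      show "(\<lambda>\<tau>. norm (g' \<tau>)) \<in> borel_measurable lebesgue"
        by (rule measurable_completion) simp
      show "AE \<tau> in lebesgue. norm (indicator {0<..} \<tau> *\<^sub>R g \<tau>) = norm (g' \<tau>)"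
        using AE_completion[OF g'(3)] by eventually_elim (simp only:)
    qed
    also have "\<dots> = (LINT \<tau>|lborel. norm (g' \<tau>))"
      by (rule integral_completion) simp
    finally show ?thesis .
  qed
  have bound: "norm (of_real (x powr \<gamma>) * kelvin_transform g x) \<le> C * (LINT \<tau>|lborel. norm (g' \<tau>))" if x: "x > 0" for x
  proof -
    have "norm (LINT \<tau>|lborel. kelvin_kernel x \<tau> * g' \<tau>) \<le> (LINT \<tau>|lborel. C * x powr (- \<gamma>) * norm (g' \<tau>))"
      by (rule Bochner_Integration.integral_norm_bound_integral[OF tr(3)[OF x x]])
         (use g'(2) nk[OF x] in \<open>auto simp: norm_mult intro!: mult_right_mono\<close>)
    then have "x powr \<gamma> * norm (kelvin_transform g x) \<le> x powr \<gamma> * (C * x powr (- \<gamma>) * (LINT \<tau>|lborel. norm (g' \<tau>)))"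
      unfolding G[OF x] by (intro mult_left_mono) auto
    also have "\<dots> = C * (LINT \<tau>|lborel. norm (g' \<tau>))"
      using x by (simp add: powr_minus)
    finally show ?thesis by (simp add: norm_mult)
  qed
  have cont: "isCont (kelvin_transform g) x" if x: "x > 0" for x
  proof -
    have "isCont (\<lambda>x. LINT \<tau>|lborel. kelvin_kernel x \<tau> * g' \<tau>) x"
    proof (rule isCont_integral_dominated)
      show "open {x / 2<..}" "x \<in> {x / 2<..}" using x by auto
      show "integrable lborel (\<lambda>\<tau>. C * (x / 2) powr (- \<gamma>) * norm (g' \<tau>))"
        using g'(2) by simp
      show "isCont (\<lambda>x. kelvin_kernel x \<tau> * g' \<tau>) x" for \<tau>
        by (intro continuous_intros isCont_kelvin_kernel[OF x])
      fix u assume u: "u \<in> {x / 2<..}"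
      then have u0: "u > 0" using x by auto
      show "(\<lambda>\<tau>. kelvin_kernel u \<tau> * g' \<tau>) \<in> borel_measurable lborel"
        using kelvin_kernel_measurable[OF u0] by measurable
      have "u powr (- \<gamma>) \<le> (x / 2) powr (- \<gamma>)"
        using u x \<gamma> by (intro powr_mono2') auto
      then have "norm (kelvin_kernel u \<tau>) \<le> C * (x / 2) powr (- \<gamma>)" for \<tau>
        using nk[OF u0, of \<tau>] C0 by (meson mult_left_mono order_trans)
      then show "norm (kelvin_kernel u \<tau> * g' \<tau>) \<le> C * (x / 2) powr (- \<gamma>) * norm (g' \<tau>)" for \<tau>
        by (simp add: norm_mult mult_right_mono)
    qed
    moreover have "eventually (\<lambda>x. kelvin_transform g x = (LINT \<tau>|lborel. kelvin_kernel x \<tau> * g' \<tau>)) (nhds x)"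
      by (rule eventually_mono[OF eventually_nhds_in_open[of "{0<..}"]]) (use x G in auto)
    ultimately show ?thesis by (subst isCont_cong)
  qed
  have mellin: "mellin (kelvin_transform g) s = exp (- s * of_real (ln 4)) / 4 * Gamma (2 * s) *
      (LINT \<tau>|lborel. Gamma (s + \<i> * of_real \<tau>) * Gamma (s - \<i> * of_real \<tau>) * g' \<tau>)" if s: "Re s > 0" for s
  proof -
    \<comment> \<open>Borel measurability on the half line follows from the continuity just
      shown.\<close>
    have "(\<lambda>x. indicator {0<..} x *\<^sub>R kelvin_transform g x) \<in> borel_measurable borel"
      by (rule borel_measurable_continuous_on_indicator)
         (auto intro!: continuous_at_imp_continuous_on cont)
    then have "mellin (kelvin_transform g) s = (LINT p|lborel. exp (s * of_real p) * (LINT \<tau>|lborel. kelvin_kernel (exp p) \<tau> * g' \<tau>))"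
      by (simp add: mellin_eq_integral_exp G)
    then show ?thesis unfolding Mellin_kelvin_transform_borel[OF g'(1,2) s] .
  qed
  have inversion:
    "vline_integrable \<gamma> (\<lambda>s. Gamma (1/2 - s) / (Gamma s * Gamma (1/2 + s))
                                 * mellin (kelvin_transform g) s * of_real y powr (- s)) \<and>
     set_integrable lebesgue {0<..}
           (\<lambda>\<tau>. bessel_K (\<i> * of_real \<tau>) (of_real (y / 2)) * (g \<tau> / of_real (cosh (pi * \<tau>)))) \<and>
     1 / (2 * of_real pi * \<i>) *
           vline_integral \<gamma> (\<lambda>s. Gamma (1/2 - s) / (Gamma s * Gamma (1/2 + s))
                                 * mellin (kelvin_transform g) s * of_real y powr (- s))
         = of_real (exp (y / 2) / 8) *
           (LINT \<tau>:{0<..}|lebesgue.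
              bessel_K (\<i> * of_real \<tau>) (of_real (y / 2)) * (g \<tau> / of_real (cosh (pi * \<tau>))))"
    if \<gamma>': "\<gamma> < 1/2" and y: "y > 0" for y
  proof -
    define F where "F = (\<lambda>s. Gamma (1/2 - s) / (Gamma s * Gamma (1/2 + s)) * mellin (kelvin_transform g) s * of_real y powr (- s))"
    define Q where "Q = (\<lambda>\<tau> t. Gamma_triple \<gamma> \<tau> t * exp (- \<i> * of_real (t * ln y)) * g' \<tau>)"
    \<comment> \<open>On the line, y^(-s) is y^(-\<gamma>) times a phase; the rest is the constant
      left by the duplication formula.\<close>
    define c where "c = complex_of_real (y powr (- \<gamma>) / (8 * sqrt pi))"
    have F: "F (Complex \<gamma> t) = c * (LINT \<tau>|lborel. Q \<tau> t)" for t
    proof -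
      define s where "s = Complex \<gamma> t"
      have s: "Re s > 0" using \<gamma> by (simp add: s_def)
      have "- s * of_real (ln y) = of_real (- \<gamma> * ln y) + (- \<i> * of_real (t * ln y))"
        by (simp add: s_def complex_eq_iff)
      then have y: "of_real y powr (- s) = of_real (y powr (- \<gamma>)) * exp (- \<i> * of_real (t * ln y))"
        using y by (simp only: powr_def exp_add exp_of_real Ln_of_real) (simp add: Ln_of_real exp_of_real)
      have "F s = Gamma (1/2 - s) / (Gamma s * Gamma (1/2 + s)) * (exp (- s * of_real (ln 4)) / 4 * Gamma (2 * s)) *
          (LINT \<tau>|lborel. Gamma (s + \<i> * of_real \<tau>) * Gamma (s - \<i> * of_real \<tau>) * g' \<tau>) * of_real y powr (- s)"
        unfolding F_def mellin[OF s] by (simp only: mult.assoc)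
      also have "\<dots> = c * (LINT \<tau>|lborel. (Gamma (1/2 - s) * exp (- \<i> * of_real (t * ln y))) * (Gamma (s + \<i> * of_real \<tau>) * Gamma (s - \<i> * of_real \<tau>) * g' \<tau>))"
        unfolding Gamma_quotient_duplication[OF s] y integral_mult_right_zero c_def by (simp add: field_simps)
      also have "\<dots> = c * (LINT \<tau>|lborel. Q \<tau> t)"
        unfolding Q_def Gamma_triple_def s_def by (simp only: mult_ac)
      finally show ?thesis by (simp only: s_def)
    qed
    have nQ: "norm (Q \<tau> t) \<le> Gamma_majorant \<gamma> \<tau> t * norm (g' \<tau>)" for \<tau> t
      using norm_Gamma_triple_le[OF \<gamma> \<gamma>', of \<tau> t] by (simp add: Q_def norm_mult mult_right_mono)
    have [measurable]: "case_prod Q \<in> borel_measurable (borel \<Otimes>\<^sub>M borel)"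
      unfolding Q_def by measurable
    have Q1: "integrable lborel (Q \<tau>)" for \<tau>
    proof (rule Bochner_Integration.integrable_bound)
      show "integrable lborel (\<lambda>t. Gamma_majorant \<gamma> \<tau> t * norm (g' \<tau>))"
        using integrable_Gamma_majorant[OF \<gamma>] by simp
      show "AE t in lborel. norm (Q \<tau> t) \<le> norm (Gamma_majorant \<gamma> \<tau> t * norm (g' \<tau>))"
        by (rule AE_I2, rule order_trans[OF nQ]) simp
    qed simp
    have iQ: "integrable (lborel \<Otimes>\<^sub>M lborel) (case_prod Q)"
    proof (rule lborel_pair.Fubini_integrable)
      show "AE \<tau> in lborel. integrable lborel (\<lambda>t. case (\<tau>, t) of (\<tau>, t) \<Rightarrow> Q \<tau> t)"
        using Q1 by simp
      show "integrable lborel (\<lambda>\<tau>. LINT t|lborel. norm (case (\<tau>, t) of (\<tau>, t) \<Rightarrow> Q \<tau> t))"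
      proof (rule Bochner_Integration.integrable_bound)
        \<comment> \<open>Independent of \<tau>, so that integrability of \<open>g'\<close> alone
          makes the iterated integral of the norm finite.\<close>
        let ?A = "Gamma (1/2 - \<gamma>) * (LINT t|lborel. (norm (Gamma (Complex \<gamma> t)))\<^sup>2)"
        show "integrable lborel (\<lambda>\<tau>. ?A * norm (g' \<tau>))" using g'(2) by simp
        show "AE \<tau> in lborel. norm (LINT t|lborel. norm (case (\<tau>, t) of (\<tau>, t) \<Rightarrow> Q \<tau> t)) \<le> norm (?A * norm (g' \<tau>))"
        proof (rule AE_I2)
          fix \<tau>
          have "(LINT t|lborel. norm (Q \<tau> t)) \<le> (LINT t|lborel. Gamma_majorant \<gamma> \<tau> t * norm (g' \<tau>))"
            by (rule integral_mono[OF integrable_norm[OF Q1] _ nQ]) (use integrable_Gamma_majorant[OF \<gamma>] in simp)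
          also have "\<dots> = ?A * norm (g' \<tau>)"
            unfolding integral_mult_left_zero integral_Gamma_majorant[OF \<gamma>] ..
          finally have "(LINT t|lborel. norm (Q \<tau> t)) \<le> ?A * norm (g' \<tau>)" .
          then show "norm (LINT t|lborel. norm (case (\<tau>, t) of (\<tau>, t) \<Rightarrow> Q \<tau> t)) \<le> norm (?A * norm (g' \<tau>))"
            unfolding prod.case real_norm_def by (intro order_trans[OF _ abs_ge_self]) simp
        qed
      qed simp
    qed simp
    have K: "bessel_K (\<i> * of_real \<tau>) (of_real (y / 2)) = bessel_F \<tau> (y / 2) / 2" for \<tau>
      by (rule bessel_K_eq_bessel_F) (use y in simp)
    define \<phi> where "\<phi> = (\<lambda>\<tau>. bessel_K (\<i> * of_real \<tau>) (of_real (y / 2)) / complex_of_real (cosh (pi * \<tau>)))"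
    have \<phi>: "\<phi> \<in> borel_measurable borel"
      unfolding \<phi>_def K by measurable
    have n\<phi>: "norm (\<phi> \<tau>) \<le> bessel_L (y / 2)" for \<tau>
    proof -
      have "norm (\<phi> \<tau>) = norm (bessel_F \<tau> (y / 2)) / (2 * cosh (pi * \<tau>))"
        unfolding \<phi>_def K by (simp add: norm_divide)
      also have "\<dots> \<le> norm (bessel_F \<tau> (y / 2)) / 1"
        using cosh_real_ge_1[of "pi * \<tau>"] by (intro divide_left_mono) auto
      finally show ?thesis using norm_bessel_F_le[of \<tau> "y / 2"] by simp
    qed
    have \<phi>g: "bessel_K (\<i> * of_real \<tau>) (of_real (y / 2)) * (g \<tau> / of_real (cosh (pi * \<tau>))) = \<phi> \<tau> * g \<tau>" for \<tau>
      by (simp add: \<phi>_def)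
    have F': "(\<lambda>t. F (Complex \<gamma> t)) \<in> borel_measurable lborel" "integrable lborel (\<lambda>t. F (Complex \<gamma> t))"
      unfolding F using lborel_pair.integrable_snd[OF iQ] by auto
    have "vline_integrable \<gamma> F"
      unfolding vline_integrable_def using F' by (simp add: integrable_completion)
    moreover have "set_integrable lebesgue {0<..} (\<lambda>\<tau>. \<phi> \<tau> * g \<tau>)"
      by (rule transfer(1)[OF \<phi> n\<phi>])
    moreover have "1 / (2 * of_real pi * \<i>) * vline_integral \<gamma> F = of_real (exp (y / 2) / 8) * (LINT \<tau>:{0<..}|lebesgue. \<phi> \<tau> * g \<tau>)"
    proof -
      have "vline_integral \<gamma> F = \<i> * (c * (LINT t|lborel. LINT \<tau>|lborel. Q \<tau> t))"
        unfolding vline_integral_def integral_completion[OF F'(1)] unfolding F integral_mult_right_zero ..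
      also have "(LINT t|lborel. LINT \<tau>|lborel. Q \<tau> t) = (LINT \<tau>|lborel. LINT t|lborel. Q \<tau> t)"
        by (rule lborel_pair.Fubini_integral[OF iQ])
      \<comment> \<open>The factor 2 stems from \<open>K\<close>: \<open>bessel_F\<close> is twice
        the Bessel function. The power of y and sqrt pi cancel against \<open>c\<close>
        below.\<close>
      also have "\<dots> = (LINT \<tau>|lborel. of_real (2 * pi * sqrt pi * y powr \<gamma> * exp (y / 2)) * (\<phi> \<tau> * g' \<tau>))"
        unfolding Q_def integral_mult_left_zero inverse_Mellin_Gamma_triple_bessel[OF \<gamma> \<gamma>' y] \<phi>_def K
        by (rule Bochner_Integration.integral_cong) (simp_all add: field_simps)
      also have "\<dots> = of_real (2 * pi * sqrt pi * y powr \<gamma> * exp (y / 2)) * (LINT \<tau>:{0<..}|lebesgue. \<phi> \<tau> * g \<tau>)"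
        unfolding integral_mult_right_zero transfer(2)[OF \<phi> n\<phi>] ..
      finally have "1 / (2 * of_real pi * \<i>) * vline_integral \<gamma> F =
          of_real (1 / (2 * pi) * (y powr (- \<gamma>) / (8 * sqrt pi)) * (2 * pi * sqrt pi * y powr \<gamma> * exp (y / 2))) * (LINT \<tau>:{0<..}|lebesgue. \<phi> \<tau> * g \<tau>)"
        unfolding c_def by (simp add: field_simps)
      also have "1 / (2 * pi) * (y powr (- \<gamma>) / (8 * sqrt pi)) * (2 * pi * sqrt pi * y powr \<gamma> * exp (y / 2)) = exp (y / 2) / 8"
        using y by (simp add: powr_minus field_simps)
      finally show ?thesis .
    qed
    ultimately show ?thesis
      unfolding \<phi>g F_def by blast
  qed
  show ?thesis
  proof (intro conjI allI impI)
    show "set_integrable lebesgue {0<..} (\<lambda>\<tau>. kelvin_kernel x \<tau> * g \<tau>)" if "x > 0" for x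
      by (rule tr(1)[OF that that])
    show "bounded ((\<lambda>x. of_real (x powr \<gamma>) * kelvin_transform g x) ` {0<..})"
      unfolding bounded_iff using bound by auto
    show "continuous_on {0<..} (\<lambda>x. of_real (x powr \<gamma>) * kelvin_transform g x)"
      by (intro continuous_at_imp_continuous_on ballI continuous_intros cont) auto
    show "(SUP x\<in>{0<..}. norm (of_real (x powr \<gamma>) * kelvin_transform g x))
       \<le> kelvin_bound \<gamma> * (LINT \<tau>:{0<..}|lebesgue. norm (g \<tau>))"
      unfolding norm_g C_def[symmetric] by (rule cSUP_least) (use bound in auto)
  qed (use inversion in blast)+
qed

end
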